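(* Let $X$ be a Banach space, $H$ a Hilbert space, and $\mathcal{K}$ a compact set in $X$. Assume that there exists a compact operator $T\in\mathcal{L}(H,X)$ such that $\mathcal{K}\subset T(B_H)$. Then $$\sigma_{3n-1}(\mathcal{K})_X\le 3e^2\,\Gamma_n(X)\Bigg(\prod_{k=0}^{n-1}d_k(T)\Bigg)^{1/n}\qquad\text{for all } n\ge1 .$$ In addition, if $X=L_p$ with $1\le p\le\infty$ and there are a constant $C_0>0$ and some $s>\big|\frac12-\frac1p\big|$ such that $d_n(T)\le C_0n^{-s}$ for all $n\ge1$, then there exists a constant $C>0$ such that $$\sigma_n(\mathcal{K})_X\le C\,n^{|1/p-1/2|-s}\qquad\text{for all } n\ge1 .$$
   Context: $\mathcal{L}(H,X)$ is the space of bounded linear operators from $H$ to $X$; $B_H$ is the closed unit ball of $H$; $X'$ is the dual of $X$. $L_p$ denotes the usual Lebesgue space over a measure space; $1/p=0$ for $p=\infty$. Greedy algorithm: for a (nonempty) compact set $\mathcal{K}$ in a Banach space $X$, choose $f_0\in\mathcal{K}$ with $\|f_0\|_X=\max_{f\in\mathcal{K}}\|f\|_X$; having chosen $f_0,\dots,f_{n-1}$, put $V_n=\operatorname{span}\{f_0,\dots,f_{n-1}\}$ and choose $f_n\in\mathcal{K}$ with $\operatorname{dist}(f_n,V_n)_X=\max_{f\in\mathcal{K}}\operatorname{dist}(f,V_n)_X$, where $\operatorname{dist}(f,V)_X=\inf_{g\in V}\|f-g\|_X$. Set $\sigma_0(\mathcal{K})_X=\|f_0\|_X$ and $\sigma_n(\mathcal{K})_X=\operatorname{dist}(f_n,V_n)_X$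 for $n\ge1$. The sequences $(f_n)$ and $(\sigma_n(\mathcal{K})_X)$ need not be unique; the statement concerns any sequence produced by this algorithm. Kolmogorov widths of an operator $T\in\mathcal{L}(H,X)$: $d_0(T)=\|T\|$ and $d_n(T)=\inf_{L_n}\sup_{\|x\|_H\le1}\inf_{y\in L_n}\|Tx-y\|_X$, the infimum over all subspaces $L_n$ of $X$ of dimension at most $n$. Grothendieck numbers: for a Banach space $X$ and $n\ge1$, $$\Gamma_n(X)=\sup\Big\{\big|\det(\langle x_i,b_j\rangle)_{i,j=1}^n\big|^{1/n}: x_1,\dots,x_n\in B_X,\ b_1,\dots,b_n\in B_{X'}\Big\}.$$ *)

theory Defs
  imports
    "Jordan_Normal_Form.Determinant"
    "HOL-Probability.Essential_Supremum"
    "HOL-Analysis.Analysis"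
begin

definition compact_operator :: "('h::real_normed_vector \<Rightarrow>\<^sub>L 'a::real_normed_vector) \<Rightarrow> bool" where
  "compact_operator T \<longleftrightarrow> compact (closure (blinfun_apply T ` cball 0 1))"

text \<open>For sets that contain 0, \<^const>\<open>infdist\<close> is the usual distance to a set.
  The maxima below are required to be attained, and ties may be broken arbitrarily.\<close>

definition greedy_sequence :: "'a::real_normed_vector set \<Rightarrow> (nat \<Rightarrow> 'a) \<Rightarrow> bool" where
  "greedy_sequence K f \<longleftrightarrow>
     f 0 \<in> K \<and> (\<forall>g\<in>K. norm g \<le> norm (f 0)) \<and>
     (\<forall>n\<ge>1. f n \<in> K \<and>
        (\<forall>g\<in>K. infdist g (span (f ` {..<n})) \<le> infdist (f n) (span (f ` {..<n}))))"

definition greedy_error :: "(nat \<Rightarrow> 'a::real_normed_vector) \<Rightarrow> nat \<Rightarrow> real" where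
  "greedy_error f n = (if n = 0 then norm (f 0) else infdist (f n) (span (f ` {..<n})))"

text \<open>The dimension bound is stated through a finite basis because \<^const>\<open>dim\<close> is 0 on
  infinite-dimensional subspaces.\<close>

definition subspaces_dim_le :: "nat \<Rightarrow> 'a::real_vector set set" where
  "subspaces_dim_le n =
     {L. subspace L \<and> (\<exists>B. finite B \<and> independent B \<and> span B = L \<and> card B \<le> n)}"

definition kolmogorov_width :: "('h::real_normed_vector \<Rightarrow>\<^sub>L 'a::real_normed_vector) \<Rightarrow> nat \<Rightarrow> real" where
  "kolmogorov_width T n =
     (if n = 0 then norm T
      else INF L\<in>subspaces_dim_le n. SUP x\<in>cball 0 1. infdist (blinfun_apply T x) L)"

text \<open>The determinant for matrices of arbitrary size n is the one from Jordan_Normal_Form;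
  elements of the dual space are bounded linear maps into the reals.
  The set below is bounded, so its supremum in the reals is meaningful (for n at least 1).\<close>

definition grothendieck_number :: "'a::real_normed_vector itself \<Rightarrow> nat \<Rightarrow> real" where
  "grothendieck_number X n =
     Sup {root n \<bar>Determinant.det (Matrix.mat n n (\<lambda>(i, j). blinfun_apply (b j) (x i)))\<bar>
         | (x :: nat \<Rightarrow> 'a) (b :: nat \<Rightarrow> 'a \<Rightarrow>\<^sub>L real).
           (\<forall>i<n. norm (x i) \<le> 1) \<and> (\<forall>j<n. norm (b j) \<le> 1)}"

definition Lp_functions :: "'m measure \<Rightarrow> ennreal \<Rightarrow> ('m \<Rightarrow> real) set" where
  "Lp_functions M p =
     {f \<in> borel_measurable M.
        if p = \<infinity> then esssup M (\<lambda>t. ennreal \<bar>f t\<bar>) < \<infinity>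
        else integrable M (\<lambda>t. \<bar>f t\<bar> powr enn2real p)}"

definition Lp_norm :: "'m measure \<Rightarrow> ennreal \<Rightarrow> ('m \<Rightarrow> real) \<Rightarrow> real" where
  "Lp_norm M p f =
     (if p = \<infinity> then enn2real (esssup M (\<lambda>t. ennreal \<bar>f t\<bar>))
      else (LINT t|M. \<bar>f t\<bar> powr enn2real p) powr (1 / enn2real p))"

text \<open>Since a type cannot depend on M and p, the Banach space type \<^typ>\<open>'a\<close> is identified with
  the space of classes of almost everywhere equal functions in \<^const>\<open>Lp_functions\<close>: J selects a
  representative of the class that corresponds to a vector, and the induced map into the
  quotient is a surjective linear isometry.\<close>

definition Lp_identification ::
    "'m measure \<Rightarrow> ennreal \<Rightarrow> ('a::real_normed_vector \<Rightarrow> 'm \<Rightarrow> real) \<Rightarrow> bool" where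
  "Lp_identification M p J \<longleftrightarrow>
     (\<forall>x. J x \<in> Lp_functions M p) \<and>
     (\<forall>x y. AE t in M. J (x + y) t = J x t + J y t) \<and>
     (\<forall>c x. AE t in M. J (c *\<^sub>R x) t = c * J x t) \<and>
     (\<forall>x. norm x = Lp_norm M p (J x)) \<and>
     (\<forall>f\<in>Lp_functions M p. \<exists>x. AE t in M. J x t = f t)"

text \<open>The reciprocal of an exponent, with value 0 at \<^term>\<open>\<infinity>\<close>.\<close>

definition exponent_inverse :: "ennreal \<Rightarrow> real" where
  "exponent_inverse p = enn2real (1 / p)"

end

(* A greedy sequence f_0, f_1, ... in T(B_H) and functionals b_j of norm at most 1 that vanish on
   V_j and take the value sigma_j at f_j give a triangular matrix b_j(f_i) with determinant
   sigma_0 ... sigma_(n-1). In the span of the b_j choose y_k with norm(y_k o T) at most (nearly)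
   d_k(T), together with unit vectors x_k, such that the matrix y_k(x_i) is unitriangular. Changing
   the basis from b to y multiplies the determinants of b_j(f_i) and of b_j(x_i) by the same factor;
   the former becomes at most prod d_k(T) by Hadamard's inequality in H, the latter becomes 1. As
   |det b_j(x_i)| <= Gamma_n^n, this yields even
     sigma_(n-1) <= Gamma_n (d_0 ... d_(n-1))^(1/n).
   For L_p, simple functions reduce Gamma_n to the finite-dimensional l_p, where a change of density
   and Hadamard's inequality give Gamma_n <= n^|1/p - 1/2|. *)

theory Submission
  imports Defs
begin

text \<open>Hahn-Banach functionals attain the distances to the V_j, but d_k(T) need not be attained
  by a subspace, nor the norm of y_k by a vector. Hence the argument admits any D_k > d_k(T): the
  gap absorbs both defects, and D_k tends to d_k(T) at the end. Choosing y_k in the span of the b_j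
  requires independent b_j, which a nonzero determinant of b_j(f_i) guarantees; a vanishing one
  leaves nothing to prove. Hadamard's inequality is applied to vectors of H and to functions on a
  finite set; positive semidefinite Gram matrices cover both, and dependent vectors show up as
  vanishing pivots. In L_p no functional is represented by a function: only its values on finitely
  many normalized indicators enter, and these form a vector of l_q norm at most 1. For p = 1 and p =
  infinity the exponent is 1/2, and Hadamard's inequality for entries of modulus at most 1 already
  gives sqrt n.\<close>

subsection \<open>Determinants and Hadamard's inequality\<close>

text \<open>Families indexed by all of nat serve as matrices of any size, so n may vary and no
  carrier conditions arise.\<close>

abbreviation fdet :: "nat \<Rightarrow> (nat \<Rightarrow> nat \<Rightarrow> real) \<Rightarrow> real" where
  "fdet n A \<equiv> Determinant.det (Matrix.mat n n (\<lambda>(i, j). A i j))"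

lemma fdet_cong:
  assumes "\<And>i j. i < n \<Longrightarrow> j < n \<Longrightarrow> A i j = B i j"
  shows "fdet n A = fdet n B"
proof -
  have "Matrix.mat n n (\<lambda>(i, j). A i j) = Matrix.mat n n (\<lambda>(i, j). B i j)"
    using assms by (intro eq_matI) auto
  then show ?thesis by simp
qed

lemma fdet_mult: "fdet n A * fdet n B = fdet n (\<lambda>i j. \<Sum>k<n. A i k * B k j)"
proof -
  have "Matrix.mat n n (\<lambda>(i, j). A i j) * Matrix.mat n n (\<lambda>(i, j). B i j)
      = Matrix.mat n n (\<lambda>(i, j). \<Sum>k<n. A i k * B k j)"
    by (rule eq_matI) (auto simp: scalar_prod_def lessThan_atLeast0)
  then show ?thesis
    using det_mult[of "Matrix.mat n n (\<lambda>(i, j). A i j)" n "Matrix.mat n n (\<lambda>(i, j). B i j)"]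
    by simp
qed

lemma fdet_transpose: "fdet n (\<lambda>i j. A j i) = fdet n A"
proof -
  have "transpose_mat (Matrix.mat n n (\<lambda>(i, j). A i j)) = Matrix.mat n n (\<lambda>(i, j). A j i)"
    by (rule eq_matI) auto
  then show ?thesis
    using Determinant.det_transpose[of "Matrix.mat n n (\<lambda>(i, j). A i j)" n] by simp
qed

lemma fdet_lower_triangular:
  assumes "\<And>i j. i < j \<Longrightarrow> j < n \<Longrightarrow> A i j = 0"
  shows "fdet n A = (\<Prod>i<n. A i i)"
proof -
  have "fdet n A = prod_list (diag_mat (Matrix.mat n n (\<lambda>(i, j). A i j)))"
    by (rule det_lower_triangular[where n = n]) (use assms in auto)
  also have "\<dots> = (\<Prod>i<n. A i i)"
    by (simp add: prod_list_diag_prod lessThan_atLeast0)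
  finally show ?thesis .
qed

lemma fdet_diag:
  assumes "\<And>i j. i < n \<Longrightarrow> j < n \<Longrightarrow> i \<noteq> j \<Longrightarrow> A i j = 0"
  shows "fdet n A = (\<Prod>i<n. A i i)"
  by (rule fdet_lower_triangular) (use assms in auto)

lemma fdet_Leibniz:
  "fdet n A = (\<Sum>p | p permutes {0..<n}. signof p * (\<Prod>i = 0..<n. A i (p i)))"
proof -
  have "fdet n A = (\<Sum>p | p permutes {0..<n}.
      signof p * (\<Prod>i = 0..<n. Matrix.mat n n (\<lambda>(i, j). A i j) $$ (i, p i)))"
    by (rule det_def') auto
  also have "\<dots> = (\<Sum>p | p permutes {0..<n}. signof p * (\<Prod>i = 0..<n. A i (p i)))"
    by (intro sum.cong prod.cong refl arg_cong2[where f="(*)"])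
      (auto simp: permutes_in_image)
  finally show ?thesis .
qed

lemma fdet_scale_rows: "fdet n (\<lambda>i j. r i * A i j) = (\<Prod>i<n. r i) * fdet n A"
proof -
  have "fdet n (\<lambda>i j. if i = j then r i else 0) = (\<Prod>i<n. r i)"
    by (subst fdet_diag) auto
  then have "(\<Prod>i<n. r i) * fdet n A = fdet n (\<lambda>i j. \<Sum>k<n. (if i = k then r i else 0) * A k j)"
    by (simp flip: fdet_mult)
  also have "\<dots> = fdet n (\<lambda>i j. r i * A i j)"
    by (rule fdet_cong) (simp add: if_distrib[of "\<lambda>x. x * _"] cong: if_cong)
  finally show ?thesis by simp
qed

lemma fdet_zero_row:
  assumes "i < n" and "\<And>j. j < n \<Longrightarrow> A i j = 0"
  shows "fdet n A = 0"
proof -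
  have "fdet n A = fdet n (\<lambda>k j. (if k = i then 0 else 1) * A k j)"
    by (rule fdet_cong) (use assms in auto)
  also have "\<dots> = 0"
    unfolding fdet_scale_rows using assms(1) by (auto intro!: exI[of _ i])
  finally show ?thesis .
qed

lemma fdet_tendsto:
  assumes "\<And>i j. i < n \<Longrightarrow> j < n \<Longrightarrow> ((\<lambda>k. A k i j) \<longlongrightarrow> B i j) F"
  shows "((\<lambda>k. fdet n (A k)) \<longlongrightarrow> fdet n B) F"
  unfolding fdet_Leibniz
  by (intro tendsto_sum tendsto_mult tendsto_const tendsto_prod assms)
    (auto simp: permutes_in_image)

section \<open>Singular matrices and homogeneous linear systems\<close>

lemma fdet_kernel:
  assumes "fdet n A = 0"
  shows "\<exists>c. (\<exists>j<n. c j \<noteq> 0) \<and> (\<forall>i<n. (\<Sum>j<n. A i j * c j) = 0)"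
proof -
  let ?A = "Matrix.mat n n (\<lambda>(i, j). A i j)"
  have "?A \<in> carrier_mat n n" by simp
  then obtain v where v: "v \<in> carrier_vec n" "v \<noteq> 0\<^sub>v n" "?A *\<^sub>v v = 0\<^sub>v n"
    using assms det_0_iff_vec_prod_zero by blast
  have "\<exists>j<n. vec_index v j \<noteq> 0"
    using v(1,2) by (metis carrier_vecD eq_vecI index_zero_vec)
  moreover have "(\<Sum>j<n. A i j * vec_index v j) = 0" if "i < n" for i
  proof -
    have "vec_index (?A *\<^sub>v v) i = 0" using v(3) that by simp
    then show ?thesis
      using that v(1) by (simp add: scalar_prod_def lessThan_atLeast0)
  qed
  ultimately show ?thesis by (intro exI[of _ "vec_index v"]) simp
qed

lemma fdet_nonzero_kernel:
  assumes "fdet n A \<noteq> 0" and "\<And>i. i < n \<Longrightarrow> (\<Sum>j<n. A i j * c j) = 0" and "j < n"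
  shows "c j = 0"
proof (rule ccontr)
  assume "c j \<noteq> 0"
  let ?A = "Matrix.mat n n (\<lambda>(i, j). A i j)"
  have "?A *\<^sub>v Matrix.vec n c = 0\<^sub>v n"
    by (rule eq_vecI) (auto simp: scalar_prod_def assms(2) simp flip: lessThan_atLeast0)
  moreover have "Matrix.vec n c \<noteq> 0\<^sub>v n"
    using \<open>c j \<noteq> 0\<close> \<open>j < n\<close> by (metis index_vec index_zero_vec(1))
  ultimately have "\<exists>v. v \<in> carrier_vec n \<and> v \<noteq> 0\<^sub>v n \<and> ?A *\<^sub>v v = 0\<^sub>v n"
    by (intro exI[of _ "Matrix.vec n c"]) simp
  then have "fdet n A = 0"
    by (simp only: det_0_iff_vec_prod_zero[OF mat_carrier])
  with assms(1) show False by simp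
qed

lemma homogeneous_system:
  assumes "finite E" and "card E < n"
  shows "\<exists>c :: nat \<Rightarrow> real. (\<exists>j<n. c j \<noteq> 0) \<and> (\<forall>e\<in>E. (\<Sum>j<n. a e j * c j) = 0)"
proof -
  obtain g where g: "bij_betw g {0..<card E} E"
    using assms(1) ex_bij_betw_nat_finite by blast
  \<comment> \<open>With fewer equations than unknowns, the missing rows are filled with zeros,
    which makes the square matrix singular.\<close>
  define A where "A i j = (if i < card E then a (g i) j else 0)" for i j
  have "fdet n A = 0"
    by (rule fdet_zero_row[OF assms(2)]) (simp add: A_def)
  from fdet_kernel[OF this] obtain c
    where c': "(\<exists>j<n. c j \<noteq> 0) \<and> (\<forall>i<n. (\<Sum>j<n. A i j * c j) = 0)"
    by (elim exE) (rule that)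
  note c = conjunct1[OF c'] conjunct2[OF c']
  have "(\<Sum>j<n. a e j * c j) = 0" if "e \<in> E" for e
  proof -
    obtain i where i: "i < card E" "e = g i"
      using g \<open>e \<in> E\<close> unfolding bij_betw_def by (elim conjE) (drule equalityD2, auto)
    show ?thesis
      using c(2)[rule_format, of i] i assms(2) by (simp add: A_def)
  qed
  with c(1) show ?thesis by (intro exI[of _ c]) simp
qed

text \<open>For a Gram matrix \<open>G i j\<close> of vectors h_i this is the inner product of the
  combinations of the h_i with coefficients c and d. Arguing with G alone avoids choosing an ambient
  space.\<close>

definition quad_form :: "nat \<Rightarrow> (nat \<Rightarrow> nat \<Rightarrow> real) \<Rightarrow> (nat \<Rightarrow> real) \<Rightarrow> (nat \<Rightarrow> real) \<Rightarrow> real" where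
  "quad_form n G c d = (\<Sum>i<n. \<Sum>j<n. c i * d j * G i j)"

lemma quad_form_commute:
  assumes "\<And>i j. i < n \<Longrightarrow> j < n \<Longrightarrow> G i j = G j i"
  shows "quad_form n G c d = quad_form n G d c"
  unfolding quad_form_def
  by (subst sum.swap) (auto intro!: sum.cong simp: assms)

lemma quad_form_diff_sum:
  assumes "finite S"
  shows "quad_form n G (\<lambda>a. c a - (\<Sum>k\<in>S. r k * U k a)) d
    = quad_form n G c d - (\<Sum>k\<in>S. r k * quad_form n G (U k) d)"
proof -
  have "(\<Sum>k\<in>S. r k * quad_form n G (U k) d)
      = (\<Sum>i<n. \<Sum>j<n. \<Sum>k\<in>S. r k * (U k i * d j * G i j))"
    unfolding quad_form_def sum_distrib_left
    by (subst sum.swap, rule sum.cong[OF refl], rule sum.swap)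
  then show ?thesis
    unfolding quad_form_def
    by (simp add: left_diff_distrib sum_subtractf sum_distrib_right sum_distrib_left mult.assoc)
qed

lemma quad_form_unit:
  "i < n \<Longrightarrow> j < n \<Longrightarrow> quad_form n G (\<lambda>a. if a = i then 1 else 0) (\<lambda>a. if a = j then 1 else 0) = G i j"
proof -
  assume ij: "i < n" "j < n"
  have "(\<Sum>b<n. (if a = i then 1 else 0) * (if b = j then 1 else 0) * G a b)
      = (if a = i then G i j else 0)" for a
    using ij by (simp add: if_distrib[of "\<lambda>x. x * _"] cong: if_cong)
  then show ?thesis using ij by (simp add: quad_form_def)
qed

text \<open>The degenerate case of Cauchy-Schwarz: along c - t d the quadratic form is affine in t
  with slope -2 Q(c,d), so a nonzero slope would make it negative somewhere.\<close>

lemma quad_form_null: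
  assumes sym: "\<And>i j. i < n \<Longrightarrow> j < n \<Longrightarrow> G i j = G j i"
    and psd: "\<And>c. 0 \<le> quad_form n G c c"
    and null: "quad_form n G d d = 0"
  shows "quad_form n G c d = 0"
proof (rule ccontr)
  let ?Q = "quad_form n G"
  assume nz: "?Q c d \<noteq> 0"
  \<comment> \<open>This t gives the form the value -1 at e = c - t d. The sum over a singleton in e
    only fits the shape of \<open>quad_form_diff_sum\<close>.\<close>
  define t where "t = (?Q c c + 1) / (2 * ?Q c d)"
  define e where "e a = c a - (\<Sum>k\<in>{0::nat}. t * d a)" for a
  have 1: "?Q e x = ?Q c x - t * ?Q d x" for x
    unfolding e_def by (subst quad_form_diff_sum) auto
  have comm: "?Q a b = ?Q b a" for a b by (rule quad_form_commute[OF sym])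
  have "?Q e e = ?Q c e - t * ?Q d e" by (rule 1)
  also have "?Q c e = ?Q c c - t * ?Q c d"
    using 1[of c] by (simp only: comm[of c e] comm[of d c])
  also have "?Q d e = ?Q c d"
    using 1[of d] null by (simp add: comm[of d e])
  finally have "?Q e e = ?Q c c - 2 * t * ?Q c d" by simp
  also have "2 * t * ?Q c d = ?Q c c + 1" using nz by (simp add: t_def)
  finally show False using psd[of e] by simp
qed

text \<open>Where a pivot \<open>quad_form n G (U k) (U k)\<close> vanishes, so does the corresponding coefficient
  (a division by zero), which is harmless by \<open>quad_form_null\<close>.\<close>

lemma gram_schmidt_psd:
  assumes sym: "\<And>i j. i < n \<Longrightarrow> j < n \<Longrightarrow> G i j = G j i"
    and psd: "\<And>c. 0 \<le> quad_form n G c c"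
  shows "\<exists>U. (\<forall>i<n. U i i = 1 \<and> (\<forall>j>i. U i j = 0)) \<and>
      (\<forall>i<n. \<forall>k<n. i \<noteq> k \<longrightarrow> quad_form n G (U i) (U k) = 0) \<and>
      (\<forall>i<n. quad_form n G (U i) (U i) \<le> G i i)"
proof -
  let ?Q = "quad_form n G"
  note comm = quad_form_commute[of n G, OF sym]
  have "\<exists>U. (\<forall>i<m. U i i = 1 \<and> (\<forall>a>i. U i a = 0)) \<and>
      (\<forall>i<m. \<forall>k<m. i \<noteq> k \<longrightarrow> ?Q (U i) (U k) = 0) \<and> (\<forall>i<m. ?Q (U i) (U i) \<le> G i i)"
    if "m \<le> n" for m
    using that
  proof (induction m)
    case 0
    then show ?case by simp
  next
    case (Suc m)
    then have "\<exists>U. (\<forall>i<m. U i i = 1 \<and> (\<forall>a>i. U i a = 0)) \<and>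
      (\<forall>i<m. \<forall>k<m. i \<noteq> k \<longrightarrow> ?Q (U i) (U k) = 0) \<and> (\<forall>i<m. ?Q (U i) (U i) \<le> G i i)"
      by (intro Suc.IH) simp
    then obtain U where "(\<forall>i<m. U i i = 1 \<and> (\<forall>a>i. U i a = 0)) \<and>
      (\<forall>i<m. \<forall>k<m. i \<noteq> k \<longrightarrow> ?Q (U i) (U k) = 0) \<and> (\<forall>i<m. ?Q (U i) (U i) \<le> G i i)"
      by (elim exE) (rule that)
    then have U: "\<And>i. i < m \<Longrightarrow> U i i = 1" "\<And>i a. i < m \<Longrightarrow> i < a \<Longrightarrow> U i a = 0"
      "\<And>i k. i < m \<Longrightarrow> k < m \<Longrightarrow> i \<noteq> k \<Longrightarrow> ?Q (U i) (U k) = 0"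
      "\<And>i. i < m \<Longrightarrow> ?Q (U i) (U i) \<le> G i i" by auto
    define e :: "nat \<Rightarrow> real" where "e a = (if a = m then 1 else 0)" for a
    define r where "r k = ?Q e (U k) / ?Q (U k) (U k)" for k
    define u where "u a = e a - (\<Sum>k<m. r k * U k a)" for a
    have lin: "?Q u d = ?Q e d - (\<Sum>k<m. r k * ?Q (U k) d)" for d
      unfolding u_def by (subst quad_form_diff_sum) auto
    have r: "r k * ?Q (U k) (U k) = ?Q e (U k)" for k
      using quad_form_null[OF sym psd, of "U k" e] by (auto simp: r_def)
    have orth: "?Q u (U k) = 0" if "k < m" for k
    proof -
      have "(\<Sum>l<m. r l * ?Q (U l) (U k)) = (\<Sum>l<m. if l = k then r k * ?Q (U k) (U k) else 0)"
        by (rule sum.cong) (use U(3) that in auto)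
      then show ?thesis using that r[of k] by (simp add: lin)
    qed
    have orth': "?Q (U k) u = 0" if "k < m" for k
      using orth[OF that] comm[of "U k" u] by simp
    \<comment> \<open>Pythagoras: Q(u,u) is \<open>G m m\<close> minus the sum of the nonnegative
      terms Q(e,U_k)^2 / Q(U_k,U_k), so orthogonalizing never lengthens a vector.\<close>
    have "?Q u u = ?Q e u - (\<Sum>k<m. r k * ?Q (U k) u)" by (rule lin)
    also have "(\<Sum>k<m. r k * ?Q (U k) u) = 0"
      by (rule sum.neutral) (simp add: orth')
    also have "?Q e u = ?Q u e" by (rule comm)
    also have "?Q u e = ?Q e e - (\<Sum>k<m. r k * ?Q (U k) e)" by (rule lin)
    also have "?Q e e = G m m"
      using quad_form_unit[of m n m G] Suc.prems by (simp add: e_def[abs_def])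
    finally have "?Q u u = G m m - (\<Sum>k<m. r k * ?Q (U k) e)" by simp
    moreover have "0 \<le> (\<Sum>k<m. r k * ?Q (U k) e)"
    proof (rule sum_nonneg)
      fix k
      have "r k * ?Q (U k) e = (?Q e (U k))\<^sup>2 / ?Q (U k) (U k)"
        using comm[of "U k" e] by (simp add: r_def power2_eq_square)
      then show "0 \<le> r k * ?Q (U k) e" using psd by simp
    qed
    ultimately have le: "?Q u u \<le> G m m" by simp
    have um: "u m = 1" "\<And>a. m < a \<Longrightarrow> u a = 0"
      by (auto simp: u_def e_def U(2))
    have 1: "\<forall>i<Suc m. (U(m := u)) i i = 1 \<and> (\<forall>a>i. (U(m := u)) i a = 0)"
      using U(1,2) um by (auto simp: less_Suc_eq)
    have 2: "\<forall>i<Suc m. \<forall>k<Suc m. i \<noteq> k \<longrightarrow> ?Q ((U(m := u)) i) ((U(m := u)) k) = 0"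
      using U(3) orth orth' by (auto simp: less_Suc_eq)
    have 3: "\<forall>i<Suc m. ?Q ((U(m := u)) i) ((U(m := u)) i) \<le> G i i"
      using U(4) le by (auto simp: less_Suc_eq)
    show ?case by (intro exI[of _ "U(m := u)"] conjI 1 2 3)
  qed
  from this[OF order_refl] show ?thesis .
qed

text \<open>The left-hand matrix is U G U^T.\<close>

lemma fdet_congruence:
  "fdet n (\<lambda>i k. quad_form n G (U i) (U k)) = fdet n U * fdet n G * fdet n U"
proof -
  have "fdet n U * fdet n G * fdet n U = fdet n U * fdet n G * fdet n (\<lambda>i j. U j i)"
    by (simp only: fdet_transpose[of n U])
  also have "\<dots> = fdet n (\<lambda>i k. \<Sum>b<n. (\<Sum>a<n. U i a * G a b) * U k b)"
    by (simp only: fdet_mult)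
  also have "\<dots> = fdet n (\<lambda>i k. quad_form n G (U i) (U k))"
    unfolding quad_form_def sum_distrib_right
    by (rule fdet_cong, subst sum.swap) (simp add: ac_simps)
  finally show ?thesis by (rule HOL.sym)
qed

text \<open>Gram-Schmidt is a unitriangular congruence: it keeps the determinant, makes the matrix
  diagonal and does not increase the diagonal entries.\<close>

lemma fdet_psd_le:
  assumes sym: "\<And>i j. i < n \<Longrightarrow> j < n \<Longrightarrow> G i j = G j i"
    and psd: "\<And>c. 0 \<le> quad_form n G c c"
  shows "fdet n G \<le> (\<Prod>i<n. G i i)"
proof -
  have "\<exists>U. (\<forall>i<n. U i i = 1 \<and> (\<forall>j>i. U i j = 0)) \<and>
      (\<forall>i<n. \<forall>k<n. i \<noteq> k \<longrightarrow> quad_form n G (U i) (U k) = 0) \<and>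
      (\<forall>i<n. quad_form n G (U i) (U i) \<le> G i i)"
    by (rule gram_schmidt_psd[OF sym psd])
  then obtain U where U: "\<forall>i<n. U i i = 1 \<and> (\<forall>j>i. U i j = 0)"
    "\<forall>i<n. \<forall>k<n. i \<noteq> k \<longrightarrow> quad_form n G (U i) (U k) = 0"
    "\<forall>i<n. quad_form n G (U i) (U i) \<le> G i i"
    by (elim exE conjE) (rule that)
  have "fdet n U = 1"
    by (subst fdet_lower_triangular) (use U in auto)
  then have "fdet n G = fdet n (\<lambda>i k. quad_form n G (U i) (U k))"
    by (simp add: fdet_congruence)
  also have "\<dots> = (\<Prod>i<n. quad_form n G (U i) (U i))"
    by (rule fdet_diag) (use U(2) in auto)
  also have "\<dots> \<le> (\<Prod>i<n. G i i)"
    by (rule prod_mono) (use psd U(3) in auto)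
  finally show ?thesis .
qed

text \<open>Squaring turns the determinant into that of W^T W, the Gram matrix of the columns, to
  which \<open>fdet_psd_le\<close> applies.\<close>

lemma Hadamard:
  assumes "\<And>j. j < n \<Longrightarrow> (\<Sum>i<n. (W i j)\<^sup>2) \<le> (\<beta> j)\<^sup>2" and "\<And>j. j < n \<Longrightarrow> 0 \<le> \<beta> j"
  shows "\<bar>fdet n W\<bar> \<le> (\<Prod>j<n. \<beta> j)"
proof (rule power2_le_imp_le)
  define P where "P j k = (\<Sum>i<n. W i j * W i k)" for j k
  have "quad_form n P c c = (\<Sum>k<n. (\<Sum>j<n. c j * W k j)\<^sup>2)" for c
  proof -
    have "(\<Sum>k<n. (\<Sum>j<n. c j * W k j)\<^sup>2)
        = (\<Sum>k<n. \<Sum>i<n. \<Sum>j<n. c i * c j * (W k i * W k j))"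
      by (simp add: power2_eq_square sum_product ac_simps)
    also have "\<dots> = (\<Sum>i<n. \<Sum>k<n. \<Sum>j<n. c i * c j * (W k i * W k j))"
      by (rule sum.swap)
    also have "\<dots> = (\<Sum>i<n. \<Sum>j<n. \<Sum>k<n. c i * c j * (W k i * W k j))"
      by (rule sum.cong[OF refl], rule sum.swap)
    also have "\<dots> = quad_form n P c c"
      by (simp add: quad_form_def P_def sum_distrib_left)
    finally show ?thesis by (rule HOL.sym)
  qed
  then have psd: "0 \<le> quad_form n P c c" for c by (simp add: sum_nonneg)
  have "\<bar>fdet n W\<bar>\<^sup>2 = fdet n (\<lambda>i j. W j i) * fdet n W"
    by (simp add: fdet_transpose[of n W] power2_eq_square)
  also have "\<dots> = fdet n P" by (simp only: fdet_mult P_def)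
  also have "\<dots> \<le> (\<Prod>j<n. P j j)"
    by (rule fdet_psd_le) (simp_all add: psd, simp add: P_def mult.commute)
  also have "\<dots> \<le> (\<Prod>j<n. (\<beta> j)\<^sup>2)"
    by (rule prod_mono) (use assms(1) in \<open>auto simp: P_def sum_nonneg simp flip: power2_eq_square\<close>)
  also have "\<dots> = (\<Prod>j<n. \<beta> j)\<^sup>2" by (simp add: prod_power_distrib)
  finally show "\<bar>fdet n W\<bar>\<^sup>2 \<le> (\<Prod>j<n. \<beta> j)\<^sup>2" .
qed (use assms(2) in \<open>auto intro: prod_nonneg\<close>)

text \<open>Hadamard's inequality for functionals: row i stands for the i-th of n vectors with Gram
  matrix G, column j for the values of a functional of norm at most \<beta> j. In an orthonormalized
  system the columns have Euclidean norm at most \<beta> j.\<close>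

lemma abs_fdet_le_Gram:
  assumes sym: "\<And>i j. i < n \<Longrightarrow> j < n \<Longrightarrow> G i j = G j i"
    and psd: "\<And>c. 0 \<le> quad_form n G c c"
    and bound: "\<And>j c. j < n \<Longrightarrow> (\<Sum>i<n. c i * B i j)\<^sup>2 \<le> (\<beta> j)\<^sup>2 * quad_form n G c c"
    and \<beta>: "\<And>j. j < n \<Longrightarrow> 0 \<le> \<beta> j"
  shows "\<bar>fdet n B\<bar> \<le> (\<Prod>i<n. sqrt (G i i)) * (\<Prod>j<n. \<beta> j)"
proof -
  have "\<exists>U. (\<forall>i<n. U i i = 1 \<and> (\<forall>j>i. U i j = 0)) \<and>
      (\<forall>i<n. \<forall>k<n. i \<noteq> k \<longrightarrow> quad_form n G (U i) (U k) = 0) \<and>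
      (\<forall>i<n. quad_form n G (U i) (U i) \<le> G i i)"
    by (rule gram_schmidt_psd[OF sym psd])
  then obtain U where U: "\<forall>i<n. U i i = 1 \<and> (\<forall>j>i. U i j = 0)"
    "\<forall>i<n. \<forall>k<n. i \<noteq> k \<longrightarrow> quad_form n G (U i) (U k) = 0"
    "\<forall>i<n. quad_form n G (U i) (U i) \<le> G i i"
    by (elim exE conjE) (rule that)
  define D where "D i = quad_form n G (U i) (U i)" for i
  define B' where "B' i j = (\<Sum>a<n. U i a * B a j)" for i j
  have D0: "0 \<le> D i" for i by (simp add: D_def psd)
  have "fdet n U = 1"
    by (subst fdet_lower_triangular) (use U in auto)
  then have detB: "fdet n B = fdet n B'"
    using fdet_mult[of n U B] by (simp add: B'_def)
  have G0: "0 \<le> G i i" if "i < n" for i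
    using U(3) that D0[of i] unfolding D_def by force
  show ?thesis
  proof (cases "\<exists>i<n. D i = 0")
    \<comment> \<open>\<open>U i\<close> has length zero here, so \<open>bound\<close> makes every
      functional vanish on it, and row i of B' is zero.\<close>
    case True
    then obtain i where i: "i < n" "D i = 0" by blast
    have "B' i j = 0" if "j < n" for j
      using bound[OF that, of "U i"] i by (simp add: B'_def D_def)
    then have "fdet n B = 0"
      unfolding detB by (rule fdet_zero_row[OF i(1)])
    then show ?thesis using \<beta> G0 by (auto intro!: mult_nonneg_nonneg prod_nonneg)
  next
    case False
    then have Dpos: "0 < D i" if "i < n" for i using D0 that less_eq_real_def by metis
    define W where "W i j = B' i j / sqrt (D i)" for i j
    \<comment> \<open>Bessel's inequality: at the Riesz representative c of column j the functional
      and the quadratic form both take the value S, so \<open>bound\<close> reads S^2 <= \<beta>^2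
      S.\<close>
    have W: "(\<Sum>i<n. (W i j)\<^sup>2) \<le> (\<beta> j)\<^sup>2" if j: "j < n" for j
    proof -
      define S where "S = (\<Sum>i<n. (W i j)\<^sup>2)"
      \<comment> \<open>The two minus signs cancel; the shape is the one of
        \<open>quad_form_diff_sum\<close> with initial vector 0.\<close>
      define c where "c a = 0 - (\<Sum>i<n. (- (B' i j / D i)) * U i a)" for a
      have S: "S = (\<Sum>i<n. B' i j / D i * B' i j)"
        unfolding S_def W_def
        by (rule sum.cong) (use D0 in \<open>auto simp: power_divide power2_eq_square\<close>)
      have "(\<Sum>a<n. c a * B a j) = (\<Sum>a<n. \<Sum>i<n. B' i j / D i * (U i a * B a j))"
        unfolding c_def by (simp add: sum_distrib_right sum_negf mult.assoc)
      also have "\<dots> = S"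
        unfolding S by (subst sum.swap) (simp add: B'_def sum_distrib_left)
      finally have c: "(\<Sum>a<n. c a * B a j) = S" .
      have lin: "quad_form n G c d = (\<Sum>i<n. B' i j / D i * quad_form n G (U i) d)" for d
      proof -
        have "quad_form n G c d
            = quad_form n G (\<lambda>_. 0) d - (\<Sum>i<n. (- (B' i j / D i)) * quad_form n G (U i) d)"
          unfolding c_def by (rule quad_form_diff_sum) simp
        then show ?thesis by (simp add: sum_negf) (simp add: quad_form_def)
      qed
      have "quad_form n G (U k) c = B' k j" if k: "k < n" for k
      proof -
        have "quad_form n G (U k) c = (\<Sum>i<n. B' i j / D i * quad_form n G (U i) (U k))"
          by (subst quad_form_commute[OF sym], assumption+) (rule lin)
        also have "\<dots> = (\<Sum>i<n. if i = k then B' k j / D k * D k else 0)"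
          by (rule sum.cong) (use U(2) k in \<open>auto simp: D_def\<close>)
        also have "\<dots> = B' k j" using k Dpos[OF k] by simp
        finally show ?thesis .
      qed
      then have "quad_form n G c c = S" unfolding S lin by simp
      with bound[OF j, of c] c have "S * S \<le> (\<beta> j)\<^sup>2 * S" by (simp add: power2_eq_square)
      moreover have "0 \<le> S" unfolding S_def by (simp add: sum_nonneg)
      ultimately show ?thesis
        unfolding S_def[symmetric] by (cases "S = 0") (auto simp: mult_le_cancel_right)
    qed
    have "fdet n B' = fdet n (\<lambda>i j. sqrt (D i) * W i j)"
      by (rule fdet_cong) (use Dpos in \<open>simp add: W_def less_imp_neq[symmetric]\<close>)
    then have "\<bar>fdet n B\<bar> = (\<Prod>i<n. sqrt (D i)) * \<bar>fdet n W\<bar>"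
      using D0 by (simp add: detB fdet_scale_rows abs_mult prod_nonneg)
    also have "\<dots> \<le> (\<Prod>i<n. sqrt (G i i)) * (\<Prod>j<n. \<beta> j)"
      by (intro mult_mono prod_mono Hadamard W \<beta> prod_nonneg conjI)
        (use U(3) D0 G0 in \<open>auto simp: D_def\<close>)
    finally show ?thesis .
  qed
qed

lemma abs_fdet_functionals_le:
  fixes h :: "nat \<Rightarrow> 'h::real_inner"
  assumes lin: "\<And>j. j < n \<Longrightarrow> linear (\<phi> j)"
    and bound: "\<And>j x. j < n \<Longrightarrow> \<bar>\<phi> j x\<bar> \<le> \<beta> j * norm x"
    and \<beta>: "\<And>j. j < n \<Longrightarrow> 0 \<le> \<beta> j"
  shows "\<bar>fdet n (\<lambda>i j. \<phi> j (h i))\<bar> \<le> (\<Prod>i<n. norm (h i)) * (\<Prod>j<n. \<beta> j)"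
proof -
  let ?G = "\<lambda>i j. inner (h i) (h j)"
  have Q: "quad_form n ?G c c = (norm (\<Sum>i<n. c i *\<^sub>R h i))\<^sup>2" for c
    by (simp add: quad_form_def power2_norm_eq_inner inner_sum_left inner_sum_right
        sum_distrib_left mult.assoc mult.left_commute inner_commute)
  have "\<bar>fdet n (\<lambda>i j. \<phi> j (h i))\<bar> \<le> (\<Prod>i<n. sqrt (?G i i)) * (\<Prod>j<n. \<beta> j)"
  proof (rule abs_fdet_le_Gram[where G = ?G])
    fix j c assume j: "j < n"
    have "(\<Sum>i<n. c i * \<phi> j (h i)) = \<phi> j (\<Sum>i<n. c i *\<^sub>R h i)"
      using lin[OF j] by (simp add: linear_sum linear_scale)
    moreover have "\<bar>\<phi> j (\<Sum>i<n. c i *\<^sub>R h i)\<bar>\<^sup>2 \<le> (\<beta> j * norm (\<Sum>i<n. c i *\<^sub>R h i))\<^sup>2"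
      by (rule power_mono[OF bound[OF j]]) simp
    ultimately show "(\<Sum>i<n. c i * \<phi> j (h i))\<^sup>2 \<le> (\<beta> j)\<^sup>2 * quad_form n ?G c c"
      by (simp add: Q power_mult_distrib)
  qed (simp_all add: Q \<beta> inner_commute)
  then show ?thesis by (simp add: norm_eq_sqrt_inner)
qed

text \<open>Pairing with \<open>Y j\<close> is a functional on l_2(I), and Cauchy-Schwarz bounds its
  norm.\<close>

lemma abs_fdet_sum_le:
  fixes X Y :: "nat \<Rightarrow> 'i \<Rightarrow> real"
  shows "\<bar>fdet n (\<lambda>i j. \<Sum>t\<in>I. X i t * Y j t)\<bar>
    \<le> (\<Prod>i<n. sqrt (\<Sum>t\<in>I. (X i t)\<^sup>2)) * (\<Prod>j<n. sqrt (\<Sum>t\<in>I. (Y j t)\<^sup>2))"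
proof -
  let ?G = "\<lambda>i j. \<Sum>t\<in>I. X i t * X j t"
  have Q: "quad_form n ?G c c = (\<Sum>t\<in>I. (\<Sum>i<n. c i * X i t)\<^sup>2)" for c
  proof -
    have "(\<Sum>t\<in>I. (\<Sum>i<n. c i * X i t)\<^sup>2)
        = (\<Sum>t\<in>I. \<Sum>i<n. \<Sum>j<n. c i * c j * (X i t * X j t))"
      by (simp add: power2_eq_square sum_product ac_simps)
    also have "\<dots> = (\<Sum>i<n. \<Sum>t\<in>I. \<Sum>j<n. c i * c j * (X i t * X j t))"
      by (rule sum.swap)
    also have "\<dots> = (\<Sum>i<n. \<Sum>j<n. \<Sum>t\<in>I. c i * c j * (X i t * X j t))"
      by (rule sum.cong[OF refl], rule sum.swap)
    also have "\<dots> = quad_form n ?G c c"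
      by (simp add: quad_form_def sum_distrib_left)
    finally show ?thesis by (rule HOL.sym)
  qed
  have "\<bar>fdet n (\<lambda>i j. \<Sum>t\<in>I. X i t * Y j t)\<bar>
      \<le> (\<Prod>i<n. sqrt (?G i i)) * (\<Prod>j<n. sqrt (\<Sum>t\<in>I. (Y j t)\<^sup>2))"
  proof (rule abs_fdet_le_Gram[where G = ?G])
    fix j c
    have "(\<Sum>i<n. c i * (\<Sum>t\<in>I. X i t * Y j t)) = (\<Sum>i<n. \<Sum>t\<in>I. c i * X i t * Y j t)"
      by (simp add: sum_distrib_left mult.assoc)
    also have "\<dots> = (\<Sum>t\<in>I. (\<Sum>i<n. c i * X i t) * Y j t)"
      by (subst sum.swap) (simp add: sum_distrib_right)
    finally have "(\<Sum>i<n. c i * (\<Sum>t\<in>I. X i t * Y j t))\<^sup>2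
        \<le> (\<Sum>t\<in>I. (\<Sum>i<n. c i * X i t)\<^sup>2) * (\<Sum>t\<in>I. (Y j t)\<^sup>2)"
      by (simp add: Cauchy_Schwarz_ineq_sum)
    then show "(\<Sum>i<n. c i * (\<Sum>t\<in>I. X i t * Y j t))\<^sup>2
        \<le> (sqrt (\<Sum>t\<in>I. (Y j t)\<^sup>2))\<^sup>2 * quad_form n ?G c c"
      by (simp add: Q sum_nonneg mult.commute)
  qed (simp_all add: Q sum_nonneg mult.commute)
  then show ?thesis by (simp add: power2_eq_square)
qed

subsection \<open>Functionals attaining the distance to a subspace\<close>

definition sublinear :: "('a::real_vector \<Rightarrow> real) \<Rightarrow> bool" where
  "sublinear q \<longleftrightarrow> (\<forall>x y. q (x + y) \<le> q x + q y) \<and> (\<forall>c>0. \<forall>x. q (c *\<^sub>R x) = c * q x)"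

lemma sublinearI:
  assumes add: "\<And>x y. q (x + y) \<le> q x + q y"
    and scale: "\<And>c x. 0 < c \<Longrightarrow> q (c *\<^sub>R x) \<le> c * q x"
  shows "sublinear q"
  unfolding sublinear_def
proof (intro conjI allI impI antisym)
  fix c :: real and x assume c: "0 < c"
  then have "q ((1 / c) *\<^sub>R c *\<^sub>R x) \<le> 1 / c * q (c *\<^sub>R x)" by (intro scale) simp
  then show "c * q x \<le> q (c *\<^sub>R x)" using c by (simp add: field_simps)
qed (use assms in auto)

lemma sublinear_add: "sublinear q \<Longrightarrow> q (x + y) \<le> q x + q y"
  and sublinear_scale: "sublinear q \<Longrightarrow> 0 < c \<Longrightarrow> q (c *\<^sub>R x) = c * q x"
  by (auto simp: sublinear_def)

lemma sublinear_zero: "sublinear q \<Longrightarrow> q 0 = 0"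
  using sublinear_scale[of q 2 0] by simp

lemma sublinear_ge: "sublinear q \<Longrightarrow> - q (- x) \<le> q x"
  using sublinear_add[of q x "- x"] by (simp add: sublinear_zero)

text \<open>Taking the infimum of q(x + t y) - t q(y) over t >= 0 lowers q enough in the direction
  -y. This is used twice: to see that a minimal sublinear functional is odd, and to force a linear
  one to touch p at a given point.\<close>

lemma sublinear_shift:
  assumes q: "sublinear q"
  shows "\<exists>r. sublinear r \<and> (\<forall>x. r x \<le> q x) \<and> r (- y) \<le> - q y"
proof -
  define g where "g x t = q (x + t *\<^sub>R y) - t * q y" for x t
  define r where "r x = (INF t\<in>{0..}. g x t)" for x
  \<comment> \<open>A lower bound independent of t, without which the infimum of reals would carry
    no information.\<close>
  have lower: "- q (- x) \<le> g x t" if "0 \<le> t" for x t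
  proof (cases "t = 0")
    case False
    then have "t * q y = q ((x + t *\<^sub>R y) + (- x))"
      using that sublinear_scale[OF q, of t y] by simp
    also have "\<dots> \<le> q (x + t *\<^sub>R y) + q (- x)" by (rule sublinear_add[OF q])
    finally show ?thesis by (simp add: g_def)
  qed (simp add: g_def sublinear_ge[OF q])
  have bdd: "bdd_below (g x ` {0..})" for x
    using lower by (intro bdd_belowI2[of _ "- q (- x)"]) simp
  have le: "r x \<le> g x t" if "0 \<le> t" for x t
    unfolding r_def using that by (intro cINF_lower bdd) simp
  have ge: "z \<le> r x" if "\<And>t. 0 \<le> t \<Longrightarrow> z \<le> g x t" for x z
    unfolding r_def using that by (intro cINF_greatest) auto
  have "sublinear r"
  proof (rule sublinearI)
    fix x x'
    have "r (x + x') - r x' \<le> r x"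
    proof (rule ge)
      fix t :: real assume t: "0 \<le> t"
      have "r (x + x') - g x t \<le> r x'"
      proof (rule ge)
        fix s :: real assume s: "0 \<le> s"
        have "q ((x + t *\<^sub>R y) + (x' + s *\<^sub>R y)) \<le> q (x + t *\<^sub>R y) + q (x' + s *\<^sub>R y)"
          by (rule sublinear_add[OF q])
        then have "g (x + x') (t + s) \<le> g x t + g x' s"
          by (simp add: g_def algebra_simps)
        with le[of "t + s" "x + x'"] t s show "r (x + x') - g x t \<le> g x' s" by simp
      qed
      then show "r (x + x') - r x' \<le> g x t" by simp
    qed
    then show "r (x + x') \<le> r x + r x'" by simp
  next
    fix c :: real and x assume c: "0 < c"
    have "r (c *\<^sub>R x) / c \<le> r x"
    proof (rule ge)
      fix t :: real assume t: "0 \<le> t"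
      have "g (c *\<^sub>R x) (c * t) = c * g x t"
        using sublinear_scale[OF q c, of "x + t *\<^sub>R y"] by (simp add: g_def algebra_simps)
      with le[of "c * t" "c *\<^sub>R x"] c t show "r (c *\<^sub>R x) / c \<le> g x t"
        by (simp add: field_simps)
    qed
    with c show "r (c *\<^sub>R x) \<le> c * r x" by (simp add: field_simps)
  qed
  moreover have "r x \<le> q x" for x using le[of 0 x] by (simp add: g_def)
  moreover have "r (- y) \<le> - q y"
    using le[of 1 "- y"] by (simp add: g_def sublinear_zero[OF q])
  ultimately show ?thesis by (intro exI[of _ r]) simp
qed

text \<open>The Hahn--Banach theorem in the form without extensions: sublinear functionals that are minimal
  below a given one are linear.\<close>

lemma minimal_sublinear_linear:
  assumes q: "sublinear q"
    and min: "\<And>r. sublinear r \<Longrightarrow> (\<And>x. r x \<le> q x) \<Longrightarrow> r = q"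
  shows "linear q"
proof -
  \<comment> \<open>By minimality the shifted functional is q itself, so q is odd; for an odd
    function subadditivity is additivity.\<close>
  have neg: "q (- y) = - q y" for y
  proof -
    from sublinear_shift[OF q, of y] obtain r
      where r: "sublinear r" "\<forall>x. r x \<le> q x" "r (- y) \<le> - q y"
      by (elim exE conjE) (rule that)
    have "r = q" by (rule min) (use r in auto)
    with r(3) sublinear_ge[OF q, of "- y"] show ?thesis by simp
  qed
  show ?thesis
  proof (rule linearI)
    fix x y
    have "q (- (x + y)) \<le> q (- x) + q (- y)"
      using sublinear_add[OF q, of "- x" "- y"] by simp
    with sublinear_add[OF q, of x y] show "q (x + y) = q x + q y"
      unfolding neg by simp
  next
    fix c :: real and x
    consider "c > 0" | "c = 0" | "c < 0" by linarith
    then show "q (c *\<^sub>R x) = c *\<^sub>R q x"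
    proof cases
      case 3
      then have "q ((- c) *\<^sub>R x) = - c * q x" by (intro sublinear_scale[OF q]) simp
      then show ?thesis using neg[of "c *\<^sub>R x"] by simp
    qed (use sublinear_scale[OF q] sublinear_zero[OF q] in auto)
  qed
qed

lemma exists_linear_le_sublinear:
  fixes p :: "'a::real_vector \<Rightarrow> real"
  assumes p: "sublinear p"
  shows "\<exists>b. linear b \<and> (\<forall>x. b x \<le> p x)"
proof -
  define A where "A = {q. sublinear q \<and> (\<forall>x. q x \<le> p x)}"
  \<comment> \<open>The order is reversed, so that the maximal element from Zorn's lemma is a
    pointwise minimal functional.\<close>
  define P where "P = (\<lambda>a b :: 'a \<Rightarrow> real. b \<le> a)"
  have "\<exists>m\<in>A. \<forall>a\<in>A. P m a \<longrightarrow> a = m"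
  proof (rule predicate_Zorn)
    show "partial_order_on A (relation_of P A)"
      by (rule partial_order_on_relation_ofI) (auto simp: P_def)
  next
    fix C assume C: "C \<in> Chains (relation_of P A)"
    then have CA: "C \<subseteq> A" by (auto simp: Chains_def relation_of_def)
    show "\<exists>u\<in>A. \<forall>a\<in>C. P a u"
    proof (cases "C = {}")
      case True
      then show ?thesis using p by (intro bexI[of _ p]) (auto simp: A_def)
    next
      case False
      define u where "u x = (INF q\<in>C. q x)" for x
      have lower: "- p (- x) \<le> q x" if "q \<in> C" for q x
      proof -
        have "sublinear q" "q (- x) \<le> p (- x)" using that CA by (auto simp: A_def)
        then show ?thesis using sublinear_ge[of q x] by linarith
      qed
      have bdd: "bdd_below ((\<lambda>q. q x) ` C)" for x
        using lower by (intro bdd_belowI2[of _ "- p (- x)"]) simp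
      have le: "u x \<le> q x" if "q \<in> C" for q x
        unfolding u_def using that by (intro cINF_lower bdd)
      have ge: "z \<le> u x" if "\<And>q. q \<in> C \<Longrightarrow> z \<le> q x" for x z
        unfolding u_def using that False by (intro cINF_greatest) auto
      have "sublinear u"
      proof (rule sublinearI)
        fix x y
        have "u (x + y) - u y \<le> u x"
        proof (rule ge)
          fix q assume q: "q \<in> C"
          have "u (x + y) - q x \<le> u y"
          proof (rule ge)
            fix q' assume q': "q' \<in> C"
            \<comment> \<open>The smaller of two members of a chain can be used at both arguments;
              this keeps the pointwise infimum subadditive.\<close>
            have "q' \<le> q \<or> q \<le> q'"
              using C q q' by (auto simp: Chains_def relation_of_def P_def)
            then obtain r where r: "r \<in> C" "r \<le> q" "r \<le> q'"
              using q q' by blast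
            have "u (x + y) \<le> r (x + y)" by (rule le[OF r(1)])
            also have "\<dots> \<le> r x + r y" using r(1) CA by (intro sublinear_add) (auto simp: A_def)
            also have "\<dots> \<le> q x + q' y" using r(2,3) by (intro add_mono) (auto simp: le_fun_def)
            finally show "u (x + y) - q x \<le> q' y" by simp
          qed
          then show "u (x + y) - u y \<le> q x" by simp
        qed
        then show "u (x + y) \<le> u x + u y" by simp
      next
        fix c :: real and x assume c: "0 < c"
        have "u (c *\<^sub>R x) / c \<le> u x"
        proof (rule ge)
          fix q assume q: "q \<in> C"
          then have "q (c *\<^sub>R x) = c * q x"
            using CA c by (intro sublinear_scale) (auto simp: A_def)
          with le[OF q, of "c *\<^sub>R x"] c show "u (c *\<^sub>R x) / c \<le> q x"
            by (simp add: field_simps)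
        qed
        with c show "u (c *\<^sub>R x) \<le> c * u x" by (simp add: field_simps)
      qed
      moreover have "u x \<le> p x" for x
      proof -
        obtain q where q: "q \<in> C" using False by auto
        then have "q x \<le> p x" using CA by (auto simp: A_def)
        with le[OF q, of x] show ?thesis by simp
      qed
      ultimately have "u \<in> A" by (simp add: A_def)
      then show ?thesis using le by (intro bexI[of _ u]) (auto simp: P_def le_fun_def)
    qed
  qed
  then obtain m where m: "m \<in> A" "\<forall>a\<in>A. P m a \<longrightarrow> a = m" by (elim bexE) (rule that)
  have "linear m"
  proof (rule minimal_sublinear_linear)
    fix r assume r: "sublinear r" "\<And>x. r x \<le> m x"
    then have "r \<in> A" using m(1) order_trans by (fastforce simp: A_def)
    then show "r = m" using m(2) r(2) by (simp add: P_def le_fun_def)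
  qed (use m in \<open>simp add: A_def\<close>)
  then show ?thesis using m(1) by (intro exI[of _ m]) (simp add: A_def)
qed

text \<open>A linear b below the shifted functional r satisfies -b(y) = b(-y) <= r(-y) <= -p(y), the
  inequality opposite to b <= p.\<close>

lemma exists_supporting_functional:
  assumes p: "sublinear p"
  shows "\<exists>b. linear b \<and> (\<forall>x. b x \<le> p x) \<and> b y = p y"
proof -
  from sublinear_shift[OF p, of y] obtain r
    where r: "sublinear r" "\<forall>x. r x \<le> p x" "r (- y) \<le> - p y"
    by (elim exE conjE) (rule that)
  from exists_linear_le_sublinear[OF r(1)] obtain b
    where b: "linear b" "\<forall>x. b x \<le> r x"
    by (elim exE conjE) (rule that)
  have le: "b x \<le> p x" for x using b(2) r(2) order_trans by blast
  have "- b y \<le> - p y"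
    using b(2) r(3) linear_neg[OF b(1), of y] by (metis order_trans)
  with le[of y] have "b y = p y" by simp
  with b(1) le show ?thesis by (intro exI[of _ b]) simp
qed

section \<open>The distance to a subspace\<close>

lemma infdist_subspace_sublinear:
  fixes V :: "'a::real_normed_vector set"
  assumes V: "subspace V"
  shows "sublinear (\<lambda>x. infdist x V)"
proof -
  have ne: "V \<noteq> {}" using subspace_0[OF V] by auto
  have ge: "z \<le> infdist x V" if "\<And>v. v \<in> V \<Longrightarrow> z \<le> dist x v" for x z
    unfolding infdist_notempty[OF ne] using ne that by (intro cINF_greatest) auto
  show ?thesis
  proof (rule sublinearI)
    fix x y
    have "infdist (x + y) V - infdist y V \<le> infdist x V"
    proof (rule ge)
      fix v assume v: "v \<in> V"
      have "infdist (x + y) V - dist x v \<le> infdist y V"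
      proof (rule ge)
        fix w assume w: "w \<in> V"
        have "infdist (x + y) V \<le> dist (x + y) (v + w)"
          by (rule infdist_le) (rule subspace_add[OF V v w])
        also have "\<dots> \<le> dist x v + dist y w" by (rule dist_triangle_add)
        finally show "infdist (x + y) V - dist x v \<le> dist y w" by simp
      qed
      then show "infdist (x + y) V - infdist y V \<le> dist x v" by simp
    qed
    then show "infdist (x + y) V \<le> infdist x V + infdist y V" by simp
  next
    fix c :: real and x assume c: "0 < c"
    have "infdist (c *\<^sub>R x) V / c \<le> infdist x V"
    proof (rule ge)
      fix v assume v: "v \<in> V"
      have "infdist (c *\<^sub>R x) V \<le> dist (c *\<^sub>R x) (c *\<^sub>R v)"
        by (rule infdist_le) (rule subspace_scale[OF V v])
      also have "\<dots> = c * dist x v"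
        using c by (simp add: dist_norm flip: scaleR_diff_right)
      finally show "infdist (c *\<^sub>R x) V / c \<le> dist x v" using c by (simp add: field_simps)
    qed
    with c show "infdist (c *\<^sub>R x) V \<le> c * infdist x V" by (simp add: field_simps)
  qed
qed

lemma infdist_subspace_le_norm:
  "subspace V \<Longrightarrow> infdist x V \<le> norm (x :: 'a::real_normed_vector)"
  using infdist_le[of 0 V x] subspace_0[of V] by simp

text \<open>The distance to V is itself sublinear, lies below the norm and vanishes on V. A linear
  functional that supports it at x therefore inherits the norm bound and, applied to v and -v, the
  vanishing on V.\<close>

lemma distance_functional:
  fixes V :: "'a::real_normed_vector set"
  assumes V: "subspace V"
  shows "\<exists>b :: 'a \<Rightarrow>\<^sub>L real. norm b \<le> 1 \<and> (\<forall>v\<in>V. blinfun_apply b v = 0) \<and>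
    blinfun_apply b x = infdist x V"
proof -
  from exists_supporting_functional[OF infdist_subspace_sublinear[OF V], of x] obtain b
    where b: "linear b" "\<forall>z. b z \<le> infdist z V" "b x = infdist x V"
    by (elim exE conjE) (rule that)
  have le: "b z \<le> norm z" for z
    using b(2) infdist_subspace_le_norm[OF V, of z] order_trans by blast
  have abs: "\<bar>b z\<bar> \<le> norm z" for z
    using le[of z] le[of "- z"] linear_neg[OF b(1), of z] by simp
  have bl: "bounded_linear b"
    using b(1) abs by (intro bounded_linear.intro bounded_linear_axioms.intro exI[of _ 1]) auto
  have 0: "b v = 0" if "v \<in> V" for v
    using b(2)[rule_format, of v] b(2)[rule_format, of "- v"] linear_neg[OF b(1), of v] that
      subspace_neg[OF V that] by simp
  have "norm (Blinfun b) \<le> 1"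
    using abs by (intro norm_blinfun_bound) (simp_all add: bounded_linear_Blinfun_apply[OF bl])
  then show ?thesis using 0 b(3)
    by (intro exI[of _ "Blinfun b"]) (simp add: bounded_linear_Blinfun_apply[OF bl])
qed

subsection \<open>Grothendieck numbers, widths and the greedy algorithm\<close>

text \<open>All entries have modulus at most 1, so the columns have Euclidean norm at most sqrt n.
  This makes the supremum in \<open>grothendieck_number\<close> finite and also settles L_1 and
  L_infinity.\<close>

lemma abs_fdet_duality_le:
  fixes x :: "nat \<Rightarrow> 'a::real_normed_vector" and b :: "nat \<Rightarrow> 'a \<Rightarrow>\<^sub>L real"
  assumes x: "\<And>i. i < n \<Longrightarrow> norm (x i) \<le> 1" and b: "\<And>j. j < n \<Longrightarrow> norm (b j) \<le> 1"
  shows "\<bar>fdet n (\<lambda>i j. blinfun_apply (b j) (x i))\<bar> \<le> sqrt (real n) ^ n"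
proof -
  have "\<bar>fdet n (\<lambda>i j. blinfun_apply (b j) (x i))\<bar> \<le> (\<Prod>j<n. sqrt (real n))"
  proof (rule Hadamard)
    fix j assume j: "j < n"
    have "(blinfun_apply (b j) (x i))\<^sup>2 \<le> 1" if i: "i < n" for i
    proof -
      have "\<bar>blinfun_apply (b j) (x i)\<bar> \<le> norm (b j) * norm (x i)"
        using norm_blinfun[of "b j" "x i"] by simp
      also have "\<dots> \<le> 1" using x[OF i] b[OF j] by (simp add: mult_le_one)
      finally show ?thesis by (simp add: abs_square_le_1)
    qed
    then have "(\<Sum>i<n. (blinfun_apply (b j) (x i))\<^sup>2) \<le> (\<Sum>i<n. 1)"
      by (intro sum_mono) simp
    then show "(\<Sum>i<n. (blinfun_apply (b j) (x i))\<^sup>2) \<le> (sqrt (real n))\<^sup>2" by simp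
  qed simp
  then show ?thesis by simp
qed

lemma grothendieck_number_le:
  assumes n: "1 \<le> n" and c: "0 \<le> c"
    and le: "\<And>(x :: nat \<Rightarrow> 'a::real_normed_vector) (b :: nat \<Rightarrow> 'a \<Rightarrow>\<^sub>L real).
      (\<forall>i<n. norm (x i) \<le> 1) \<Longrightarrow> (\<forall>j<n. norm (b j) \<le> 1) \<Longrightarrow>
      \<bar>fdet n (\<lambda>i j. blinfun_apply (b j) (x i))\<bar> \<le> c ^ n"
  shows "grothendieck_number TYPE('a) n \<le> c"
  unfolding grothendieck_number_def
proof (rule cSup_least)
  show "{root n \<bar>fdet n (\<lambda>i j. blinfun_apply (b j) (x i))\<bar> | (x :: nat \<Rightarrow> 'a)
      (b :: nat \<Rightarrow> 'a \<Rightarrow>\<^sub>L real). (\<forall>i<n. norm (x i) \<le> 1) \<and> (\<forall>j<n. norm (b j) \<le> 1)} \<noteq> {}"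
    by (auto intro!: exI[of _ "\<lambda>_. 0"])
next
  fix z assume "z \<in> {root n \<bar>fdet n (\<lambda>i j. blinfun_apply (b j) (x i))\<bar> | (x :: nat \<Rightarrow> 'a)
      (b :: nat \<Rightarrow> 'a \<Rightarrow>\<^sub>L real). (\<forall>i<n. norm (x i) \<le> 1) \<and> (\<forall>j<n. norm (b j) \<le> 1)}"
  then obtain x b where z: "z = root n \<bar>fdet n (\<lambda>i j. blinfun_apply (b j) (x i :: 'a))\<bar>"
    and xb: "\<forall>i<n. norm (x i) \<le> 1" "\<forall>j<n. norm (b j) \<le> 1"
    by (elim CollectE exE conjE) (rule that)
  have "z \<le> root n (c ^ n)"
    unfolding z using n le[OF xb] by (intro real_root_le_mono) auto
  then show "z \<le> c" using n c by (simp add: real_root_power_cancel)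
qed

lemma root_abs_fdet_le_grothendieck:
  fixes x :: "nat \<Rightarrow> 'a::real_normed_vector" and b :: "nat \<Rightarrow> 'a \<Rightarrow>\<^sub>L real"
  assumes n: "1 \<le> n"
    and x: "\<And>i. i < n \<Longrightarrow> norm (x i) \<le> 1" and b: "\<And>j. j < n \<Longrightarrow> norm (b j) \<le> 1"
  shows "root n \<bar>fdet n (\<lambda>i j. blinfun_apply (b j) (x i))\<bar> \<le> grothendieck_number TYPE('a) n"
  unfolding grothendieck_number_def
proof (rule cSup_upper)
  let ?S = "{root n \<bar>fdet n (\<lambda>i j. blinfun_apply (b j) (x i))\<bar> | (x :: nat \<Rightarrow> 'a)
      (b :: nat \<Rightarrow> 'a \<Rightarrow>\<^sub>L real). (\<forall>i<n. norm (x i) \<le> 1) \<and> (\<forall>j<n. norm (b j) \<le> 1)}"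
  show "root n \<bar>fdet n (\<lambda>i j. blinfun_apply (b j) (x i))\<bar> \<in> ?S"
    using x b by auto
  show "bdd_above ?S"
  proof (rule bdd_aboveI)
    fix z assume "z \<in> ?S"
    then obtain x b where z: "z = root n \<bar>fdet n (\<lambda>i j. blinfun_apply (b j) (x i :: 'a))\<bar>"
      and xb: "\<forall>i<n. norm (x i) \<le> 1" "\<forall>j<n. norm (b j) \<le> 1"
      by (elim CollectE exE conjE) (rule that)
    show "z \<le> root n (sqrt (real n) ^ n)"
      unfolding z using n xb by (intro real_root_le_mono abs_fdet_duality_le) auto
  qed
qed

lemma abs_fdet_le_grothendieck:
  fixes x :: "nat \<Rightarrow> 'a::real_normed_vector" and b :: "nat \<Rightarrow> 'a \<Rightarrow>\<^sub>L real"
  assumes n: "1 \<le> n"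
    and x: "\<And>i. i < n \<Longrightarrow> norm (x i) \<le> 1" and b: "\<And>j. j < n \<Longrightarrow> norm (b j) \<le> 1"
  shows "\<bar>fdet n (\<lambda>i j. blinfun_apply (b j) (x i))\<bar> \<le> grothendieck_number TYPE('a) n ^ n"
proof -
  have "root n \<bar>fdet n (\<lambda>i j. blinfun_apply (b j) (x i))\<bar> ^ n
      \<le> grothendieck_number TYPE('a) n ^ n"
    by (intro power_mono root_abs_fdet_le_grothendieck n x b real_root_ge_zero abs_ge_zero)
  then show ?thesis using n by simp
qed

lemma grothendieck_number_nonneg:
  assumes "1 \<le> n"
  shows "0 \<le> grothendieck_number TYPE('a::real_normed_vector) n"
proof -
  have "0 \<le> root n \<bar>fdet n (\<lambda>i j. blinfun_apply (0 :: 'a \<Rightarrow>\<^sub>L real) 0)\<bar>"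
    by (simp add: real_root_ge_zero)
  also have "\<dots> \<le> grothendieck_number TYPE('a) n"
    using assms by (intro root_abs_fdet_le_grothendieck[where x = "\<lambda>_. 0" and b = "\<lambda>_. 0"]) simp_all
  finally show ?thesis .
qed

section \<open>Kolmogorov widths and functionals adapted to them\<close>

lemma width_deviation:
  fixes T :: "'h::real_normed_vector \<Rightarrow>\<^sub>L 'a::real_normed_vector"
  assumes L: "subspace L"
  shows "bdd_above ((\<lambda>x. infdist (blinfun_apply T x) L) ` cball 0 1)"
    and "0 \<le> (SUP x\<in>cball 0 1. infdist (blinfun_apply T x) L)"
proof -
  show bdd: "bdd_above ((\<lambda>x. infdist (blinfun_apply T x) L) ` cball 0 1)"
  proof (rule bdd_aboveI2)
    fix x :: 'h assume "x \<in> cball 0 1"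
    then have "norm T * norm x \<le> norm T" by (simp add: mult_left_le)
    with norm_blinfun[of T x] infdist_subspace_le_norm[OF L, of "blinfun_apply T x"]
    show "infdist (blinfun_apply T x) L \<le> norm T" by linarith
  qed
  show "0 \<le> (SUP x\<in>cball 0 1. infdist (blinfun_apply T x) L)"
    by (rule cSUP_upper2[OF bdd, of 0]) (simp_all add: infdist_nonneg)
qed

lemma subspaces_dim_le_subspace: "L \<in> subspaces_dim_le n \<Longrightarrow> subspace L"
  by (simp add: subspaces_dim_le_def)

lemma subspaces_dim_le_nonempty: "subspaces_dim_le n \<noteq> {}"
proof -
  have "{0} \<in> subspaces_dim_le n"
    unfolding subspaces_dim_le_def
    by (auto intro!: exI[of _ "{}"] simp: independent_empty)
  then show ?thesis by blast
qed

lemma kolmogorov_width_nonneg: "0 \<le> kolmogorov_width T n"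
  unfolding kolmogorov_width_def
  by (auto intro!: cINF_greatest subspaces_dim_le_nonempty width_deviation(2)
      subspaces_dim_le_subspace)

text \<open>An optimal subspace need not exist. The strict gap between S and D is kept because it
  also has to pay for a vector that only almost norms a functional.\<close>

lemma kolmogorov_width_subspace:
  fixes T :: "'h::real_normed_vector \<Rightarrow>\<^sub>L 'a::real_normed_vector"
  assumes D: "kolmogorov_width T k < D"
  shows "\<exists>B S. finite B \<and> card B \<le> k \<and> 0 \<le> S \<and> S < D \<and>
    (\<forall>h. norm h \<le> 1 \<longrightarrow> infdist (blinfun_apply T h) (span B) \<le> S)"
proof (cases "k = 0")
  \<comment> \<open>Width 0 is the operator norm by definition; it is the deviation from the span of
    the empty set.\<close>
  case True
  have "infdist (blinfun_apply T h) (span {}) \<le> norm T" if "norm h \<le> 1" for h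
  proof -
    have "norm T * norm h \<le> norm T" using that by (simp add: mult_left_le)
    with norm_blinfun[of T h] show ?thesis by simp
  qed
  then show ?thesis using True D
    by (intro exI[of _ "{}"] exI[of _ "norm T"]) (simp add: kolmogorov_width_def)
next
  case False
  let ?F = "\<lambda>L. SUP x\<in>cball 0 1. infdist (blinfun_apply T x) L"
  have "bdd_below (?F ` subspaces_dim_le k)"
    by (rule bdd_belowI2[of _ 0]) (rule width_deviation(2)[OF subspaces_dim_le_subspace])
  moreover have "(INF L\<in>subspaces_dim_le k. ?F L) < D"
    using D False by (simp add: kolmogorov_width_def)
  ultimately have "\<exists>L\<in>subspaces_dim_le k. ?F L < D"
    by (simp add: cINF_less_iff[OF subspaces_dim_le_nonempty])
  then obtain L where L: "L \<in> subspaces_dim_le k" "?F L < D" by (elim bexE) (rule that)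
  note sub = subspaces_dim_le_subspace[OF L(1)]
  obtain B where B: "finite B" "span B = L" "card B \<le> k"
    using L(1) by (auto simp: subspaces_dim_le_def)
  have "infdist (blinfun_apply T h) L \<le> ?F L" if "norm h \<le> 1" for h
    using that by (intro cSUP_upper width_deviation(1)[OF sub]) simp
  then show ?thesis using B L(2) width_deviation(2)[OF sub, of T]
    by (intro exI[of _ B] exI[of _ "?F L"]) simp
qed

lemma annihilator_abs_le:
  fixes y :: "'a::real_normed_vector \<Rightarrow>\<^sub>L real"
  assumes V: "subspace V" and y: "\<And>v. v \<in> V \<Longrightarrow> blinfun_apply y v = 0"
  shows "\<bar>blinfun_apply y x\<bar> \<le> norm y * infdist x V"
proof (cases "norm y = 0")
  case False
  have "\<bar>blinfun_apply y x\<bar> / norm y \<le> infdist x V"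
  proof -
    have ne: "V \<noteq> {}" using subspace_0[OF V] by auto
    show ?thesis
      unfolding infdist_notempty[OF ne]
    proof (rule cINF_greatest[OF ne])
      fix v assume v: "v \<in> V"
      have "\<bar>blinfun_apply y x\<bar> = norm (blinfun_apply y (x - v))"
        using y[OF v] by (simp add: blinfun.diff_right)
      also have "\<dots> \<le> norm y * dist x v"
        unfolding dist_norm by (rule norm_blinfun)
      finally show "\<bar>blinfun_apply y x\<bar> / norm y \<le> dist x v"
        using False by (simp add: field_simps)
    qed
  qed
  then show ?thesis using False by (simp add: field_simps)
qed simp

lemma exists_almost_norming:
  fixes y :: "'a::real_normed_vector \<Rightarrow>\<^sub>L real"
  assumes "y \<noteq> 0" and \<theta>: "0 \<le> \<theta>" "\<theta> < 1"
  shows "\<exists>z. norm z \<le> 1 \<and> \<theta> * norm y < \<bar>blinfun_apply y z\<bar>"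
proof (rule ccontr)
  assume "\<nexists>z. norm z \<le> 1 \<and> \<theta> * norm y < \<bar>blinfun_apply y z\<bar>"
  then have *: "\<bar>blinfun_apply y z\<bar> \<le> \<theta> * norm y" if "norm z \<le> 1" for z
    using that by (meson not_le)
  have "norm y \<le> \<theta> * norm y"
  proof (rule norm_blinfun_bound)
    fix x
    show "norm (blinfun_apply y x) \<le> \<theta> * norm y * norm x"
    proof (cases "x = 0")
      case False
      have "\<bar>blinfun_apply y (inverse (norm x) *\<^sub>R x)\<bar> \<le> \<theta> * norm y"
        using False by (intro *) simp
      then show ?thesis using False
        by (simp add: blinfun.scaleR_right abs_mult field_simps)
    qed (simp add: blinfun.zero_right)
  qed (use \<theta> in simp)
  moreover have "\<theta> * norm y < norm y" using assms by simp
  ultimately show False by simp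
qed

text \<open>A functional y that annihilates \<open>span B\<close> satisfies |y(T h)| <= norm y * S.
  Dividing by its value at an almost norming z makes y(z) = 1 and turns the bound into D.\<close>

lemma exists_width_functional:
  fixes T :: "'h::real_normed_vector \<Rightarrow>\<^sub>L 'a::real_normed_vector"
    and b :: "nat \<Rightarrow> 'a \<Rightarrow>\<^sub>L real"
  assumes k: "k < n" and D: "kolmogorov_width T k < D"
    and indep: "\<forall>c. (\<Sum>j<n. c j *\<^sub>R b j) = 0 \<longrightarrow> (\<forall>j<n. c j = 0)"
  shows "\<exists>c z. norm z \<le> 1 \<and> blinfun_apply (\<Sum>j<n. c j *\<^sub>R b j) z = 1 \<and>
    (\<forall>i. k < i \<longrightarrow> i < n \<longrightarrow> blinfun_apply (\<Sum>j<n. c j *\<^sub>R b j) (x i) = 0) \<and>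
    (\<forall>h. norm h \<le> 1 \<longrightarrow> \<bar>blinfun_apply (\<Sum>j<n. c j *\<^sub>R b j) (blinfun_apply T h)\<bar> \<le> D)"
proof -
  from kolmogorov_width_subspace[OF D] obtain B S where B: "finite B" "card B \<le> k"
    and S: "0 \<le> S" "S < D"
      "\<forall>h. norm h \<le> 1 \<longrightarrow> infdist (blinfun_apply T h) (span B) \<le> S"
    by (elim exE conjE) (rule that)
  let ?E = "B \<union> x ` {k<..<n}"
  have "card (x ` {k<..<n}) \<le> n - Suc k"
    using card_image_le[of "{k<..<n}" x] by simp
  then have "card ?E < n" using card_Un_le[of B "x ` {k<..<n}"] B(2) k by linarith
  moreover have "finite ?E" using B(1) by simp
  ultimately have "\<exists>c. (\<exists>j<n. c j \<noteq> 0) \<and> (\<forall>e\<in>?E. (\<Sum>j<n. blinfun_apply (b j) e * c j) = 0)"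
    by (intro homogeneous_system)
  then obtain c where c: "(\<exists>j<n. c j \<noteq> 0) \<and> (\<forall>e\<in>?E. (\<Sum>j<n. blinfun_apply (b j) e * c j) = 0)"
    by (elim exE) (rule that)
  define y where "y = (\<Sum>j<n. c j *\<^sub>R b j)"
  have y: "blinfun_apply y e = (\<Sum>j<n. blinfun_apply (b j) e * c j)" for e
    by (simp add: y_def blinfun.sum_left blinfun.scaleR_left mult.commute)
  have "y \<noteq> 0" using indep[rule_format, of c] c by (auto simp: y_def)
  have yE: "blinfun_apply y e = 0" if "e \<in> ?E" for e using c that by (simp add: y)
  have yspan: "blinfun_apply y v = 0" if "v \<in> span B" for v
    using that
    by (induction rule: span_induct_alt)
      (simp_all add: blinfun.zero_right blinfun.add_right blinfun.scaleR_right yE)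
  \<comment> \<open>From S <= \<theta> D and \<theta> * norm y < |y(z)| follows norm y * S <= |y(z)|
    D. The value 1/2 keeps \<theta> positive when S = 0.\<close>
  define \<theta> where "\<theta> = max (S / D) (1 / 2)"
  have Dpos: "0 < D" using S by linarith
  have \<theta>: "0 < \<theta>" "\<theta> < 1" "S \<le> \<theta> * D"
    using S Dpos by (auto simp: \<theta>_def field_simps max_def)
  from exists_almost_norming[OF \<open>y \<noteq> 0\<close>, of \<theta>] \<theta> obtain z
    where z: "norm z \<le> 1" "\<theta> * norm y < \<bar>blinfun_apply y z\<bar>"
    by auto
  define a where "a = blinfun_apply y z"
  have "0 \<le> \<theta> * norm y" using \<theta> by simp
  with z(2) have a: "a \<noteq> 0" by (auto simp: a_def)
  have sum: "(\<Sum>j<n. (c j / a) *\<^sub>R b j) = (1 / a) *\<^sub>R y"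
    by (simp add: y_def scaleR_sum_right)
  have bound: "\<bar>blinfun_apply y (blinfun_apply T h)\<bar> \<le> D * \<bar>a\<bar>" if h: "norm h \<le> 1" for h
  proof -
    have "\<bar>blinfun_apply y (blinfun_apply T h)\<bar>
        \<le> norm y * infdist (blinfun_apply T h) (span B)"
      by (rule annihilator_abs_le[OF subspace_span yspan])
    also have "\<dots> \<le> norm y * (\<theta> * D)"
      using S(3) h \<theta>(3) by (intro mult_left_mono) auto
    also have "\<dots> = (\<theta> * norm y) * D" by simp
    also have "\<dots> \<le> \<bar>a\<bar> * D" using z(2) Dpos by (intro mult_right_mono) (auto simp: a_def)
    finally show ?thesis by (simp add: mult.commute)
  qed
  show ?thesis
    unfolding y_def[symmetric]
  proof (intro exI[of _ "\<lambda>j. c j / a"] exI[of _ z] conjI allI impI)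
    show "blinfun_apply (\<Sum>j<n. (c j / a) *\<^sub>R b j) z = 1"
      using a by (simp add: sum blinfun.scaleR_left flip: a_def)
  next
    fix i assume "k < i" "i < n"
    then show "blinfun_apply (\<Sum>j<n. (c j / a) *\<^sub>R b j) (x i) = 0"
      by (simp add: sum blinfun.scaleR_left yE)
  next
    fix h :: 'h assume "norm h \<le> 1"
    from bound[OF this] show
      "\<bar>blinfun_apply (\<Sum>j<n. (c j / a) *\<^sub>R b j) (blinfun_apply T h)\<bar> \<le> D"
      using a by (simp add: sum blinfun.scaleR_left field_simps)
  qed (rule z(1))
qed

text \<open>The functionals are chosen for \<open>k = n - 1, \<dots>, 0\<close>: annihilating a space of dimension at most
  \<open>k\<close> and the \<open>n - 1 - k\<close> vectors already chosen leaves one free dimension in the span of the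
  \<open>b j\<close>.\<close>

lemma exists_width_biorthogonal:
  fixes T :: "'h::real_normed_vector \<Rightarrow>\<^sub>L 'a::real_normed_vector"
    and b :: "nat \<Rightarrow> 'a \<Rightarrow>\<^sub>L real"
  assumes D: "\<forall>k<n. kolmogorov_width T k < D k"
    and indep: "\<forall>c. (\<Sum>j<n. c j *\<^sub>R b j) = 0 \<longrightarrow> (\<forall>j<n. c j = 0)"
  shows "\<exists>c x. \<forall>k<n. norm (x k) \<le> 1 \<and> blinfun_apply (\<Sum>j<n. c k j *\<^sub>R b j) (x k) = 1 \<and>
    (\<forall>i. k < i \<longrightarrow> i < n \<longrightarrow> blinfun_apply (\<Sum>j<n. c k j *\<^sub>R b j) (x i) = 0) \<and>
    (\<forall>h. norm h \<le> 1 \<longrightarrow> \<bar>blinfun_apply (\<Sum>j<n. c k j *\<^sub>R b j) (blinfun_apply T h)\<bar> \<le> D k)"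
proof -
  define P where "P c x k \<longleftrightarrow> norm (x k) \<le> 1 \<and> blinfun_apply (\<Sum>j<n. c k j *\<^sub>R b j) (x k) = 1 \<and>
    (\<forall>i. k < i \<longrightarrow> i < n \<longrightarrow> blinfun_apply (\<Sum>j<n. c k j *\<^sub>R b j) (x i) = 0) \<and>
    (\<forall>h. norm h \<le> 1 \<longrightarrow> \<bar>blinfun_apply (\<Sum>j<n. c k j *\<^sub>R b j) (blinfun_apply T h)\<bar> \<le> D k)"
    for c :: "nat \<Rightarrow> nat \<Rightarrow> real" and x :: "nat \<Rightarrow> 'a" and k
  have "\<exists>c x. \<forall>k. n \<le> k + m \<longrightarrow> k < n \<longrightarrow> P c x k" if "m \<le> n" for m
    using that
  proof (induction m)
    case 0
    then show ?case by simp
  next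
    case (Suc m)
    then have "\<exists>c x. \<forall>k. n \<le> k + m \<longrightarrow> k < n \<longrightarrow> P c x k" by simp
    then obtain c x where cx: "\<forall>k. n \<le> k + m \<longrightarrow> k < n \<longrightarrow> P c x k" by (elim exE) (rule that)
    let ?k = "n - Suc m"
    have k: "?k < n" using Suc.prems by simp
    from exists_width_functional[OF k D[rule_format, OF k] indep, of x] obtain c' z where
      z: "norm z \<le> 1" "blinfun_apply (\<Sum>j<n. c' j *\<^sub>R b j) z = 1"
        "\<forall>i. ?k < i \<longrightarrow> i < n \<longrightarrow> blinfun_apply (\<Sum>j<n. c' j *\<^sub>R b j) (x i) = 0"
        "\<forall>h. norm h \<le> 1 \<longrightarrow> \<bar>blinfun_apply (\<Sum>j<n. c' j *\<^sub>R b j) (blinfun_apply T h)\<bar> \<le> D ?k"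
      by (elim exE conjE) (rule that)
    have "\<forall>k. n \<le> k + Suc m \<longrightarrow> k < n \<longrightarrow> P (c(?k := c')) (x(?k := z)) k"
    proof (intro allI impI)
      fix k assume that: "n \<le> k + Suc m" "k < n"
      show "P (c(?k := c')) (x(?k := z)) k"
      proof (cases "k = ?k")
        case True
        then show ?thesis using z by (simp add: P_def)
      next
        case False
        then have "n \<le> k + m" using that by linarith
        then have "P c x k" using cx that(2) by blast
        moreover have "i \<noteq> ?k" if "k < i" for i
          using that \<open>n \<le> k + m\<close> by linarith
        ultimately show ?thesis using False by (simp add: P_def)
      qed
    qed
    then show ?case by (intro exI)
  qed
  from this[OF order_refl] show ?thesis by (simp add: P_def)
qed

lemma abs_fdet_operator_le:
  fixes T :: "'h::real_inner \<Rightarrow>\<^sub>L 'a::real_normed_vector"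
    and b :: "nat \<Rightarrow> 'a \<Rightarrow>\<^sub>L real"
  assumes n: "1 \<le> n"
    and b: "\<And>j. j < n \<Longrightarrow> norm (b j) \<le> 1" and h: "\<And>i. i < n \<Longrightarrow> norm (h i) \<le> 1"
    and D: "\<And>k. k < n \<Longrightarrow> kolmogorov_width T k < D k"
  shows "\<bar>fdet n (\<lambda>i j. blinfun_apply (b j) (blinfun_apply T (h i)))\<bar>
    \<le> grothendieck_number TYPE('a) n ^ n * (\<Prod>k<n. D k)"
proof -
  let ?A = "\<lambda>i j. blinfun_apply (b j) (blinfun_apply T (h i))"
  have D0: "0 < D k" if "k < n" for k
    using D[OF that] kolmogorov_width_nonneg[of T k] by linarith
  show ?thesis
  proof (cases "fdet n ?A = 0")
    case True
    then show ?thesis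
      using D0 by (auto intro!: mult_nonneg_nonneg zero_le_power prod_nonneg
          grothendieck_number_nonneg n intro: less_imp_le)
  next
    case False
    have apply_sum: "blinfun_apply (\<Sum>j<n. c j *\<^sub>R b j) z = (\<Sum>j<n. blinfun_apply (b j) z * c j)"
      for c z by (simp add: blinfun.sum_left blinfun.scaleR_left mult.commute)
    \<comment> \<open>A linear relation among the b_j would be a kernel vector of the nonsingular
      matrix \<open>?A\<close>.\<close>
    have indep: "\<forall>c. (\<Sum>j<n. c j *\<^sub>R b j) = 0 \<longrightarrow> (\<forall>j<n. c j = 0)"
    proof (intro allI impI)
      fix c j assume c: "(\<Sum>j<n. c j *\<^sub>R b j) = 0" and "j < n"
      show "c j = 0"
      proof (rule fdet_nonzero_kernel[OF False _ \<open>j < n\<close>])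
        fix i
        have "(\<Sum>j<n. ?A i j * c j)
            = blinfun_apply (\<Sum>j<n. c j *\<^sub>R b j) (blinfun_apply T (h i))"
          by (rule apply_sum[symmetric])
        then show "(\<Sum>j<n. ?A i j * c j) = 0" by (simp only: c blinfun.zero_left)
      qed
    qed
    from exists_width_biorthogonal[OF _ indep, of T D] D obtain c x where
      cx: "\<forall>k<n. norm (x k) \<le> 1 \<and> blinfun_apply (\<Sum>j<n. c k j *\<^sub>R b j) (x k) = 1 \<and>
        (\<forall>i. k < i \<longrightarrow> i < n \<longrightarrow> blinfun_apply (\<Sum>j<n. c k j *\<^sub>R b j) (x i) = 0) \<and>
        (\<forall>h. norm h \<le> 1 \<longrightarrow>
          \<bar>blinfun_apply (\<Sum>j<n. c k j *\<^sub>R b j) (blinfun_apply T h)\<bar> \<le> D k)"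
      by auto
    define y where "y k = (\<Sum>j<n. c k j *\<^sub>R b j)" for k
    have yb: "blinfun_apply (y k) z = (\<Sum>j<n. blinfun_apply (b j) z * c k j)" for k z
      unfolding y_def by (rule apply_sum)
    have x: "norm (x k) \<le> 1" "blinfun_apply (y k) (x k) = 1" if "k < n" for k
      using cx that by (simp_all add: y_def)
    have x0: "blinfun_apply (y k) (x i) = 0" if "k < i" "i < n" for i k
      using cx that by (simp add: y_def)
    have yT: "\<bar>blinfun_apply (y k) (blinfun_apply T h)\<bar> \<le> D k" if "k < n" "norm h \<le> 1" for k h
      using cx that by (simp add: y_def)
    \<comment> \<open>Since \<open>y k (x i)\<close> is unitriangular, the coordinate change from \<open>b\<close> to \<open>y\<close> has the
      reciprocal determinant of \<open>b j (x i)\<close>.\<close>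
    let ?C = "fdet n (\<lambda>j k. c k j)"
    have "fdet n (\<lambda>i k. blinfun_apply (y k) (x i)) = fdet n (\<lambda>k i. blinfun_apply (y k) (x i))"
      by (rule fdet_transpose)
    also have "\<dots> = (\<Prod>k<n. blinfun_apply (y k) (x k))"
      by (rule fdet_lower_triangular) (rule x0)
    also have "\<dots> = 1" using x(2) by simp
    finally have 1: "fdet n (\<lambda>i j. blinfun_apply (b j) (x i)) * ?C = 1"
      by (simp add: fdet_mult yb)
    have yT': "\<bar>blinfun_apply (y k) (blinfun_apply T u)\<bar> \<le> D k * norm u" if k: "k < n" for k u
    proof (cases "u = 0")
      case False
      have "\<bar>blinfun_apply (y k) (blinfun_apply T (inverse (norm u) *\<^sub>R u))\<bar> \<le> D k"
        using False by (intro yT k) simp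
      then show ?thesis using False
        by (simp add: blinfun.scaleR_right abs_mult field_simps)
    qed (simp add: blinfun.zero_right)
    have "\<bar>fdet n (\<lambda>i k. blinfun_apply (y k) (blinfun_apply T (h i)))\<bar>
        \<le> (\<Prod>i<n. norm (h i)) * (\<Prod>k<n. D k)"
    proof (rule abs_fdet_functionals_le)
      fix k
      show "linear (\<lambda>u. blinfun_apply (y k) (blinfun_apply T u))"
        by (rule linearI) (simp_all add: blinfun.add_right blinfun.scaleR_right)
    qed (use yT' D0 in \<open>auto intro: less_imp_le\<close>)
    also have "\<dots> \<le> 1 * (\<Prod>k<n. D k)"
      using h D0 by (intro mult_right_mono prod_le_1 prod_nonneg) (auto intro: less_imp_le)
    finally have 2: "\<bar>fdet n ?A * ?C\<bar> \<le> (\<Prod>k<n. D k)"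
      by (simp add: fdet_mult yb)
    have "\<bar>fdet n ?A\<bar> = \<bar>fdet n ?A * ?C\<bar> * \<bar>fdet n (\<lambda>i j. blinfun_apply (b j) (x i))\<bar>"
      using arg_cong[OF 1, of abs] by (simp add: abs_mult ac_simps)
    also have "\<dots> \<le> (\<Prod>k<n. D k) * grothendieck_number TYPE('a) n ^ n"
      using n x(1) b D0
      by (intro mult_mono 2 abs_fdet_le_grothendieck prod_nonneg) (auto intro: less_imp_le)
    finally show ?thesis by (simp add: mult.commute)
  qed
qed

section \<open>Errors of the greedy algorithm\<close>

lemma greedy_error_eq:
  "greedy_error f n = infdist (f n) (span (f ` {..<n}))"
  \<comment> \<open>For n = 0 the span of the empty set is {0}, and the distance to it is the
    norm.\<close>
  by (simp add: greedy_error_def)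

lemma greedy_mem: "greedy_sequence K f \<Longrightarrow> f n \<in> K"
  by (cases "n = 0") (auto simp: greedy_sequence_def)

text \<open>The element chosen in step n + 1 was already a candidate in step n, and the space of
  step n is contained in the next one.\<close>

lemma greedy_error_Suc_le:
  assumes f: "greedy_sequence K f"
  shows "greedy_error f (Suc n) \<le> greedy_error f n"
proof -
  have "greedy_error f (Suc n) \<le> infdist (f (Suc n)) (span (f ` {..<n}))"
    unfolding greedy_error_eq by (intro infdist_mono span_mono) (auto simp: span_0 intro: span_zero)
  also have "\<dots> \<le> greedy_error f n"
    using f greedy_mem[OF f, of "Suc n"]
    by (cases "n = 0") (auto simp: greedy_error_def greedy_sequence_def)
  finally show ?thesis .
qed

lemma greedy_error_antimono:
  "greedy_sequence K f \<Longrightarrow> m \<le> n \<Longrightarrow> greedy_error f n \<le> greedy_error f m"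
  by (rule lift_Suc_antimono_le[of "greedy_error f"]) (auto intro: greedy_error_Suc_le)

lemma greedy_error_nonneg: "0 \<le> greedy_error f n"
  by (simp add: greedy_error_eq infdist_nonneg)

lemma greedy_error_le:
  fixes T :: "'h::real_inner \<Rightarrow>\<^sub>L 'a::real_normed_vector"
  assumes K: "K \<subseteq> blinfun_apply T ` cball 0 1"
    and f: "greedy_sequence K f" and n: "1 \<le> n"
  shows "greedy_error f (n - 1)
    \<le> grothendieck_number TYPE('a) n * root n (\<Prod>k<n. kolmogorov_width T k)"
proof -
  let ?V = "\<lambda>j. span (f ` {..<j})"
  have "\<forall>j. \<exists>b :: 'a \<Rightarrow>\<^sub>L real. norm b \<le> 1 \<and> (\<forall>v\<in>?V j. blinfun_apply b v = 0) \<and>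
      blinfun_apply b (f j) = infdist (f j) (?V j)"
    by (intro allI distance_functional subspace_span)
  then obtain b :: "nat \<Rightarrow> 'a \<Rightarrow>\<^sub>L real" where b: "\<forall>j. norm (b j) \<le> 1 \<and>
      (\<forall>v\<in>?V j. blinfun_apply (b j) v = 0) \<and> blinfun_apply (b j) (f j) = infdist (f j) (?V j)"
    by (drule_tac choice) (elim exE, rule that)
  have "\<forall>i. \<exists>h. f i = blinfun_apply T h \<and> norm h \<le> 1"
    using greedy_mem[OF f] K by fastforce
  then obtain h where h: "\<forall>i. f i = blinfun_apply T (h i) \<and> norm (h i) \<le> 1"
    by (drule_tac choice) (elim exE, rule that)
  \<comment> \<open>The errors decrease, so the last of the n errors is at most their geometric
    mean.\<close>
  have "greedy_error f (n - 1) ^ n = (\<Prod>i<n. greedy_error f (n - 1))" by simp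
  also have "\<dots> \<le> (\<Prod>i<n. greedy_error f i)"
    using greedy_error_antimono[OF f] by (intro prod_mono) (auto simp: greedy_error_nonneg)
  also have "\<dots> = (\<Prod>i<n. blinfun_apply (b i) (f i))"
    using b by (simp add: greedy_error_eq)
  also have "\<dots> = fdet n (\<lambda>i j. blinfun_apply (b j) (f i))"
  proof (rule fdet_lower_triangular[symmetric])
    fix i j :: nat assume "i < j"
    then have "f i \<in> ?V j" by (intro span_base) simp
    then show "blinfun_apply (b j) (f i) = 0" using b by blast
  qed
  also have "\<dots> \<le> \<bar>fdet n (\<lambda>i j. blinfun_apply (b j) (blinfun_apply T (h i)))\<bar>"
    using h by simp
  finally have le: "greedy_error f (n - 1) ^ n
      \<le> \<bar>fdet n (\<lambda>i j. blinfun_apply (b j) (blinfun_apply T (h i)))\<bar>" .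
  let ?\<Gamma> = "grothendieck_number TYPE('a) n"
  \<comment> \<open>\<open>abs_fdet_operator_le\<close> demands numbers strictly above the widths;
    d_k + \<epsilon> is admissible, and the bound is continuous in \<epsilon>.\<close>
  have "greedy_error f (n - 1) ^ n \<le> ?\<Gamma> ^ n * (\<Prod>k<n. kolmogorov_width T k)"
  proof (rule tendsto_lowerbound)
    show "((\<lambda>\<epsilon>. ?\<Gamma> ^ n * (\<Prod>k<n. kolmogorov_width T k + \<epsilon>)) \<longlongrightarrow>
        ?\<Gamma> ^ n * (\<Prod>k<n. kolmogorov_width T k)) (at_right 0)"
      by (auto intro!: tendsto_eq_intros)
    show "\<forall>\<^sub>F \<epsilon> in at_right 0.
        greedy_error f (n - 1) ^ n \<le> ?\<Gamma> ^ n * (\<Prod>k<n. kolmogorov_width T k + \<epsilon>)"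
      unfolding eventually_at_right_field
    proof (intro exI[of _ 1] conjI allI impI)
      fix \<epsilon> :: real assume "0 < \<epsilon>" "\<epsilon> < 1"
      then have "\<bar>fdet n (\<lambda>i j. blinfun_apply (b j) (blinfun_apply T (h i)))\<bar>
          \<le> ?\<Gamma> ^ n * (\<Prod>k<n. kolmogorov_width T k + \<epsilon>)"
        using b h by (intro abs_fdet_operator_le n) auto
      with le show "greedy_error f (n - 1) ^ n
          \<le> ?\<Gamma> ^ n * (\<Prod>k<n. kolmogorov_width T k + \<epsilon>)" by linarith
    qed simp
  qed simp
  then have "root n (greedy_error f (n - 1) ^ n)
      \<le> root n (?\<Gamma> ^ n * (\<Prod>k<n. kolmogorov_width T k))"
    using n by (intro real_root_le_mono) auto
  then show ?thesis
    using n greedy_error_nonneg[of f "n - 1"] grothendieck_number_nonneg[OF n, where 'a='a]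
    by (simp add: real_root_mult real_root_power_cancel)
qed

subsection \<open>Determinants in finite-dimensional \<open>l\<^sub>p\<close>\<close>

text \<open>Multiplying one factor by a power of the averaged density \<open>v\<close> of the vectors \<open>X i\<close>, and
  the other one by its inverse, turns the duality of \<open>l\<^sub>p\<close> and \<open>l\<^sub>q\<close> into an inner product, to which
  Hadamard's inequality applies. Where \<open>v\<close> vanishes, so do all \<open>X i\<close>.\<close>

lemma abs_fdet_lp_le:
  fixes X Y :: "nat \<Rightarrow> 'i \<Rightarrow> real"
  assumes n: "1 \<le> n" and p: "1 < p" "p \<le> 2" and pq: "1 / p + 1 / q = 1"
    and X: "\<And>i. i < n \<Longrightarrow> (\<Sum>t\<in>I. \<bar>X i t\<bar> powr p) \<le> 1"
    and Y: "\<And>j. j < n \<Longrightarrow> (\<Sum>t\<in>I. \<bar>Y j t\<bar> powr q) \<le> 1"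
  shows "\<bar>fdet n (\<lambda>i j. \<Sum>t\<in>I. X i t * Y j t)\<bar> \<le> (real n powr (1 / p - 1 / 2)) ^ n"
proof -
  define v where "v t = (\<Sum>i<n. \<bar>X i t\<bar> powr p) / n" for t
  \<comment> \<open>The exponent is the one that turns p-th powers into squares: if n = 1, then v =
    |X|^p and |X'| = |X|^(p/2).\<close>
  define X' where "X' i t = X i t * v t powr (1 / 2 - 1 / p)" for i t
  define Y' where "Y' j t = Y j t * v t powr (1 / p - 1 / 2)" for j t
  have v0: "0 \<le> v t" for t by (simp add: v_def sum_nonneg)
  have Xv: "\<bar>X i t\<bar> powr p \<le> n * v t" if "i < n" for i t
  proof -
    have "\<bar>X i t\<bar> powr p \<le> (\<Sum>i<n. \<bar>X i t\<bar> powr p)"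
      by (rule member_le_sum) (use that in auto)
    then show ?thesis using n by (simp add: v_def)
  qed
  have sum_v: "(\<Sum>t\<in>I. v t) \<le> 1"
  proof -
    have "(\<Sum>t\<in>I. v t) = (\<Sum>i<n. \<Sum>t\<in>I. \<bar>X i t\<bar> powr p) / n"
      unfolding v_def sum_divide_distrib[symmetric] by (subst sum.swap) (rule refl)
    also have "\<dots> \<le> (\<Sum>i<n. 1) / n"
      by (intro divide_right_mono sum_mono X) auto
    finally show ?thesis using n by simp
  qed
  have XY: "X' i t * Y' j t = X i t * Y j t" if "i < n" for i j t
  proof (cases "v t = 0")
    case True
    then have "X i t = 0" using Xv[OF that, of t] p by simp
    then show ?thesis by (simp add: X'_def)
  next
    case False
    then have "v t powr (1 / 2 - 1 / p) * v t powr (1 / p - 1 / 2) = 1"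
      using powr_add[of "v t" "1 / 2 - 1 / p" "1 / p - 1 / 2"] by simp
    then show ?thesis by (simp add: X'_def Y'_def ac_simps)
  qed
  have X': "(\<Sum>t\<in>I. (X' i t)\<^sup>2) \<le> real n powr (2 / p - 1)" if i: "i < n" for i
  proof -
    \<comment> \<open>X^2 splits as |X|^p times (|X|^p)^(2/p - 1). As p <= 2, the second factor is
      at most (n v)^(2/p - 1), whose power of v cancels the weight in X'.\<close>
    have "(X' i t)\<^sup>2 \<le> real n powr (2 / p - 1) * \<bar>X i t\<bar> powr p" for t
    proof (cases "X i t = 0")
      case False
      define x where "x = \<bar>X i t\<bar>"
      have x: "0 < x" using False by (simp add: x_def)
      have "0 < x powr p" using x by simp
      with Xv[OF i, of t] have "0 < n * v t" unfolding x_def by linarith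
      then have v: "0 < v t" using v0[of t] by (simp add: zero_less_mult_iff)
      have "(X i t)\<^sup>2 = x powr p * (x powr p) powr (2 / p - 1)"
      proof -
        have "x powr p * (x powr p) powr (2 / p - 1) = x powr (p + p * (2 / p - 1))"
          by (simp add: powr_powr powr_add)
        also have "p + p * (2 / p - 1) = 2" using p by (simp add: field_simps)
        finally show ?thesis using x by (simp add: x_def)
      qed
      also have "\<dots> \<le> x powr p * (n * v t) powr (2 / p - 1)"
        using p Xv[OF i, of t] by (intro mult_left_mono powr_mono2) (auto simp: x_def)
      finally have "(X i t)\<^sup>2 * (v t powr (1 / 2 - 1 / p))\<^sup>2
          \<le> x powr p * (n * v t) powr (2 / p - 1) * (v t powr (1 / 2 - 1 / p))\<^sup>2"
        by (rule mult_right_mono) simp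
      also have v2: "(v t powr (1 / 2 - 1 / p))\<^sup>2 = v t powr (1 - 2 / p)"
        using powr_add[of "v t" "1 / 2 - 1 / p" "1 / 2 - 1 / p"] by (simp add: power2_eq_square)
      also have "x powr p * (n * v t) powr (2 / p - 1) * v t powr (1 - 2 / p)
          = real n powr (2 / p - 1) * x powr p * (v t powr (2 / p - 1) * v t powr (1 - 2 / p))"
        using v by (simp add: powr_mult)
      also have "v t powr (2 / p - 1) * v t powr (1 - 2 / p) = 1"
        using v powr_add[of "v t" "2 / p - 1" "1 - 2 / p"] by simp
      finally show ?thesis
        by (simp add: X'_def x_def power_mult_distrib v2)
    qed (simp add: X'_def)
    then have "(\<Sum>t\<in>I. (X' i t)\<^sup>2) \<le> real n powr (2 / p - 1) * (\<Sum>t\<in>I. \<bar>X i t\<bar> powr p)"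
      unfolding sum_distrib_left by (intro sum_mono)
    also have "\<dots> \<le> real n powr (2 / p - 1) * 1"
      by (intro mult_left_mono X i) simp
    finally show ?thesis by simp
  qed
  have q: "2 \<le> q"
  proof -
    have "1 / 2 \<le> 1 / p" using p by (simp add: field_simps)
    then have "1 / q \<le> 1 / 2" using pq by simp
    moreover have "1 / p < 1" using p by simp
    then have "0 < 1 / q" using pq by linarith
    then have "0 < q" by simp
    ultimately show ?thesis by (simp add: field_simps)
  qed
  have Y': "(\<Sum>t\<in>I. (Y' j t)\<^sup>2) \<le> 1" if j: "j < n" for j
  proof -
    \<comment> \<open>Young's inequality with weights 2/q and 1 - 2/q separates Y from v. Since
      |Y|^q and v both sum to at most 1, so does the right-hand side.\<close>
    have "(Y' j t)\<^sup>2 \<le> 2 / q * \<bar>Y j t\<bar> powr q + (1 - 2 / q) * v t" for t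
    proof (cases "Y j t = 0 \<or> v t = 0")
      case True
      then have "(Y' j t)\<^sup>2 = 0" by (auto simp: Y'_def)
      then show ?thesis using q v0[of t] by simp
    next
      case False
      define y where "y = \<bar>Y j t\<bar>"
      have y: "0 < y" and v: "0 < v t" using False v0[of t] by (auto simp: y_def)
      have "(Y' j t)\<^sup>2 = y\<^sup>2 * (v t powr (1 / p - 1 / 2))\<^sup>2"
        by (simp add: Y'_def y_def power_mult_distrib)
      also have "(v t powr (1 / p - 1 / 2))\<^sup>2 = v t powr (2 * (1 / p) - 1)"
        using powr_add[of "v t" "1 / p - 1 / 2" "1 / p - 1 / 2"] by (simp add: power2_eq_square)
      also have "2 * (1 / p) - 1 = 1 - 2 / q" using pq by (simp add: field_simps)
      also have "y\<^sup>2 = (y powr q) powr (2 / q)"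
        using y q by (simp add: powr_powr powr_numeral)
      also have "(y powr q) powr (2 / q) * v t powr (1 - 2 / q)
          \<le> 2 / q * y powr q + (1 - 2 / q) * v t"
        using q y v by (intro Youngs_inequality_0) auto
      finally show ?thesis by (simp add: y_def)
    qed
    then have "(\<Sum>t\<in>I. (Y' j t)\<^sup>2)
        \<le> (\<Sum>t\<in>I. 2 / q * \<bar>Y j t\<bar> powr q + (1 - 2 / q) * v t)"
      by (intro sum_mono)
    also have "\<dots> = 2 / q * (\<Sum>t\<in>I. \<bar>Y j t\<bar> powr q) + (1 - 2 / q) * (\<Sum>t\<in>I. v t)"
      by (simp add: sum.distrib sum_distrib_left)
    also have "\<dots> \<le> 2 / q * 1 + (1 - 2 / q) * 1"
      using q by (intro add_mono mult_left_mono Y j sum_v) auto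
    finally show ?thesis by simp
  qed
  have sqrt_n: "sqrt (real n powr (2 / p - 1)) = real n powr (1 / p - 1 / 2)"
    using n by (simp add: powr_half_sqrt[symmetric] powr_powr diff_divide_distrib)
  have "fdet n (\<lambda>i j. \<Sum>t\<in>I. X i t * Y j t) = fdet n (\<lambda>i j. \<Sum>t\<in>I. X' i t * Y' j t)"
    by (rule fdet_cong) (simp add: XY)
  then have "\<bar>fdet n (\<lambda>i j. \<Sum>t\<in>I. X i t * Y j t)\<bar>
      \<le> (\<Prod>i<n. sqrt (\<Sum>t\<in>I. (X' i t)\<^sup>2)) * (\<Prod>j<n. sqrt (\<Sum>t\<in>I. (Y' j t)\<^sup>2))"
    using abs_fdet_sum_le[of n X' Y' I] by simp
  also have "\<dots> \<le> (\<Prod>i<n. sqrt (real n powr (2 / p - 1))) * (\<Prod>j<n. 1)"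
    using X' Y' by (intro mult_mono prod_mono prod_nonneg) (auto simp: sum_nonneg)
  finally show ?thesis by (simp add: sqrt_n)
qed

text \<open>For p > 2 transposition exchanges X and Y, hence p and q, and q < 2. The exponent
  becomes 1/q - 1/2 = 1/2 - 1/p, whence the absolute value.\<close>

lemma abs_fdet_lp_duality_le:
  fixes X Y :: "nat \<Rightarrow> 'i \<Rightarrow> real"
  assumes n: "1 \<le> n" and p: "1 < p" and pq: "1 / p + 1 / q = 1"
    and X: "\<And>i. i < n \<Longrightarrow> (\<Sum>t\<in>I. \<bar>X i t\<bar> powr p) \<le> 1"
    and Y: "\<And>j. j < n \<Longrightarrow> (\<Sum>t\<in>I. \<bar>Y j t\<bar> powr q) \<le> 1"
  shows "\<bar>fdet n (\<lambda>i j. \<Sum>t\<in>I. X i t * Y j t)\<bar> \<le> (real n powr \<bar>1 / p - 1 / 2\<bar>) ^ n"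
proof (cases "p \<le> 2")
  case True
  then have "0 \<le> 1 / p - 1 / 2" using p by (simp add: field_simps)
  then show ?thesis using abs_fdet_lp_le[OF n p True pq X Y] by simp
next
  case False
  have "1 / p < 1 / 2" using False by (simp add: field_simps)
  then have "1 / 2 < 1 / q" using pq by simp
  moreover have "0 < 1 / q" using \<open>1 / 2 < 1 / q\<close> by linarith
  then have "0 < q" by simp
  ultimately have q2: "q \<le> 2" by (simp add: field_simps)
  have "0 < 1 / p" using p by simp
  then have "1 / q < 1" using pq by linarith
  then have q1: "1 < q" using \<open>0 < q\<close> by (simp add: field_simps)
  have qp: "1 / q + 1 / p = 1" using pq by simp
  have "fdet n (\<lambda>i j. \<Sum>t\<in>I. X i t * Y j t) = fdet n (\<lambda>i j. \<Sum>t\<in>I. Y i t * X j t)"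
    using fdet_transpose[of n "\<lambda>i j. \<Sum>t\<in>I. Y i t * X j t"] by (simp add: mult.commute)
  also have "\<bar>\<dots>\<bar> \<le> (real n powr (1 / q - 1 / 2)) ^ n"
    by (rule abs_fdet_lp_le[OF n q1 q2 qp Y X])
  also have "1 / q - 1 / 2 = \<bar>1 / p - 1 / 2\<bar>" using pq \<open>1 / p < 1 / 2\<close> by simp
  finally show ?thesis .
qed

text \<open>The coefficients a are extremal in Hoelder's inequality: b takes the value S at the
  combination of the u_t, whose norm has p-th power S. So S^p <= S, which for p > 1 forces S <=
  1.\<close>

lemma lp_basis_dual_norm:
  fixes u :: "'i \<Rightarrow> 'a::real_normed_vector" and b :: "'a \<Rightarrow>\<^sub>L real"
  assumes p: "1 < p" and pq: "1 / p + 1 / q = 1"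
    and u: "\<And>a. norm (\<Sum>t\<in>I. a t *\<^sub>R u t) powr p = (\<Sum>t\<in>I. \<bar>a t\<bar> powr p)"
    and b: "norm b \<le> 1"
  shows "(\<Sum>t\<in>I. \<bar>blinfun_apply b (u t)\<bar> powr q) \<le> 1"
proof -
  define S where "S = (\<Sum>t\<in>I. \<bar>blinfun_apply b (u t)\<bar> powr q)"
  define a where "a t = sgn (blinfun_apply b (u t)) * \<bar>blinfun_apply b (u t)\<bar> powr (q - 1)" for t
  have S0: "0 \<le> S" by (simp add: S_def sum_nonneg)
  have q0: "q \<noteq> 0" using pq p by auto
  then have qp: "(q - 1) * p = q" using pq p by (simp add: field_simps)
  have "S = (\<Sum>t\<in>I. a t * blinfun_apply b (u t))"
    unfolding S_def
  proof (rule sum.cong[OF refl])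
    fix t
    show "\<bar>blinfun_apply b (u t)\<bar> powr q = a t * blinfun_apply b (u t)"
    proof (cases "blinfun_apply b (u t) = 0")
      case False
      have "\<bar>blinfun_apply b (u t)\<bar> powr q
          = \<bar>blinfun_apply b (u t)\<bar> powr (q - 1) * \<bar>blinfun_apply b (u t)\<bar> powr 1"
        unfolding powr_add[symmetric] by simp
      also have "\<bar>blinfun_apply b (u t)\<bar> powr 1 = sgn (blinfun_apply b (u t)) * blinfun_apply b (u t)"
        by (simp add: abs_if sgn_if)
      finally show ?thesis by (simp add: a_def)
    qed simp
  qed
  also have "\<dots> = blinfun_apply b (\<Sum>t\<in>I. a t *\<^sub>R u t)"
    by (simp add: blinfun.sum_right blinfun.scaleR_right)
  also have "\<dots> \<le> norm b * norm (\<Sum>t\<in>I. a t *\<^sub>R u t)"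
    using norm_blinfun[of b "\<Sum>t\<in>I. a t *\<^sub>R u t"] by simp
  also have "\<dots> \<le> norm (\<Sum>t\<in>I. a t *\<^sub>R u t)" using b by (simp add: mult_left_le_one_le)
  finally have "S powr p \<le> norm (\<Sum>t\<in>I. a t *\<^sub>R u t) powr p"
    using S0 p by (intro powr_mono2) auto
  also have "\<dots> = (\<Sum>t\<in>I. \<bar>a t\<bar> powr p)" by (rule u)
  also have "\<dots> = S"
    unfolding S_def
  proof (rule sum.cong[OF refl])
    fix t
    show "\<bar>a t\<bar> powr p = \<bar>blinfun_apply b (u t)\<bar> powr q"
      by (cases "blinfun_apply b (u t) = 0") (simp_all add: a_def abs_mult powr_powr qp abs_sgn_eq)
  qed
  finally have le: "S powr p \<le> S" .
  show ?thesis
  proof (rule ccontr)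
    assume "\<not> ?thesis"
    then have "1 < S" by (simp add: S_def)
    then have "S powr 1 < S powr p" using p by (intro powr_less_mono) auto
    with le \<open>1 < S\<close> show False by simp
  qed
qed

subsection \<open>Grothendieck numbers of \<open>L\<^sub>p\<close>\<close>

text \<open>The determinant is continuous in the vectors. The approximating tuples will be
  combinations of normalized indicators.\<close>

lemma abs_fdet_le_approximation:
  fixes x :: "nat \<Rightarrow> 'a::real_normed_vector" and b :: "nat \<Rightarrow> 'a \<Rightarrow>\<^sub>L real"
  assumes approx: "\<And>\<epsilon>. 0 < \<epsilon> \<Longrightarrow> \<exists>x'. (\<forall>i<n. norm (x i - x' i) < \<epsilon>) \<and>
    \<bar>fdet n (\<lambda>i j. blinfun_apply (b j) (x' i))\<bar> \<le> C"
  shows "\<bar>fdet n (\<lambda>i j. blinfun_apply (b j) (x i))\<bar> \<le> C"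
proof -
  have "\<forall>k. \<exists>x'. (\<forall>i<n. norm (x i - x' i) < inverse (real (Suc k))) \<and>
      \<bar>fdet n (\<lambda>i j. blinfun_apply (b j) (x' i))\<bar> \<le> C"
    by (intro allI approx) simp
  then obtain x' where x': "\<forall>k. (\<forall>i<n. norm (x i - x' k i) < inverse (real (Suc k))) \<and>
      \<bar>fdet n (\<lambda>i j. blinfun_apply (b j) (x' k i))\<bar> \<le> C"
    by (drule_tac choice) (elim exE, rule that)
  have lim: "(\<lambda>k. x' k i) \<longlonglongrightarrow> x i" if "i < n" for i
  proof (rule LIM_zero_cancel, rule tendsto_0_le[OF LIMSEQ_inverse_real_of_nat])
    show "\<forall>\<^sub>F k in sequentially. norm (x' k i - x i) \<le> norm (inverse (real (Suc k))) * 1"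
      using x' that by (intro always_eventually allI) (simp add: norm_minus_commute less_imp_le)
  qed
  have "(\<lambda>k. fdet n (\<lambda>i j. blinfun_apply (b j) (x' k i)))
      \<longlonglongrightarrow> fdet n (\<lambda>i j. blinfun_apply (b j) (x i))"
    by (intro fdet_tendsto blinfun.tendsto lim tendsto_const)
  then have "(\<lambda>k. \<bar>fdet n (\<lambda>i j. blinfun_apply (b j) (x' k i))\<bar>)
      \<longlonglongrightarrow> \<bar>fdet n (\<lambda>i j. blinfun_apply (b j) (x i))\<bar>"
    by (rule tendsto_rabs)
  then show ?thesis
    by (rule LIMSEQ_le_const2) (use x' in auto)
qed

text \<open>Simple functions F_k with |F_k| <= 2 |f| converge pointwise to f; then |f - F_k| <= 3
  |f|, and 3^P |f|^P is an integrable majorant for dominated convergence.\<close>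

lemma simple_approx_powr:
  fixes f :: "'m \<Rightarrow> real"
  assumes f[measurable]: "f \<in> borel_measurable M" and P: "0 < P"
    and int: "integrable M (\<lambda>t. \<bar>f t\<bar> powr P)" and \<delta>: "0 < \<delta>"
  shows "\<exists>s. simple_function M s \<and> integrable M (\<lambda>t. \<bar>s t\<bar> powr P) \<and>
    (LINT t|M. \<bar>f t - s t\<bar> powr P) < \<delta>"
proof -
  from borel_measurable_implies_sequence_metric[OF f, of 0] obtain F where
    F: "\<forall>k. simple_function M (F k)" "\<forall>t\<in>space M. (\<lambda>k. F k t) \<longlonglongrightarrow> f t"
      "\<forall>k. \<forall>t\<in>space M. dist (F k t) 0 \<le> 2 * dist (f t) 0"
    by (elim exE conjE) (rule that)
  have F2: "\<bar>F k t\<bar> \<le> 2 * \<bar>f t\<bar>" if "t \<in> space M" for k t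
    using F(3) that by simp
  have meas[measurable]: "F k \<in> borel_measurable M" for k
    using F(1) by (simp add: borel_measurable_simple_function)
  have intF: "integrable M (\<lambda>t. \<bar>F k t\<bar> powr P)" for k
  proof (rule Bochner_Integration.integrable_bound)
    show "integrable M (\<lambda>t. 2 powr P * \<bar>f t\<bar> powr P)" using int by simp
    show "AE t in M. norm (\<bar>F k t\<bar> powr P) \<le> norm (2 powr P * \<bar>f t\<bar> powr P)"
    proof (rule AE_I2)
      fix t assume "t \<in> space M"
      then have "\<bar>F k t\<bar> powr P \<le> (2 * \<bar>f t\<bar>) powr P"
        using P F2 by (intro powr_mono2) auto
      then show "norm (\<bar>F k t\<bar> powr P) \<le> norm (2 powr P * \<bar>f t\<bar> powr P)"
        by (simp add: powr_mult)
    qed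
  qed measurable
  have "(\<lambda>k. LINT t|M. \<bar>f t - F k t\<bar> powr P) \<longlonglongrightarrow> (LINT t|M. 0)"
  proof (rule integral_dominated_convergence)
    show "integrable M (\<lambda>t. 3 powr P * \<bar>f t\<bar> powr P)" using int by simp
    show "AE t in M. (\<lambda>k. \<bar>f t - F k t\<bar> powr P) \<longlonglongrightarrow> 0"
    proof (rule AE_I2)
      fix t assume "t \<in> space M"
      then have "(\<lambda>k. \<bar>f t - F k t\<bar>) \<longlonglongrightarrow> \<bar>f t - f t\<bar>"
        using F(2) by (intro tendsto_intros) auto
      then show "(\<lambda>k. \<bar>f t - F k t\<bar> powr P) \<longlonglongrightarrow> 0"
        using P by (intro tendsto_zero_powrI[where b = P]) auto
    qed
    fix k
    show "AE t in M. norm (\<bar>f t - F k t\<bar> powr P) \<le> 3 powr P * \<bar>f t\<bar> powr P"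
    proof (rule AE_I2)
      fix t assume "t \<in> space M"
      from F2[OF this, of k] have "\<bar>f t - F k t\<bar> \<le> 3 * \<bar>f t\<bar>" by linarith
      then have "\<bar>f t - F k t\<bar> powr P \<le> (3 * \<bar>f t\<bar>) powr P"
        using P by (intro powr_mono2) auto
      then show "norm (\<bar>f t - F k t\<bar> powr P) \<le> 3 powr P * \<bar>f t\<bar> powr P"
        by (simp add: powr_mult)
    qed
  qed measurable
  then have "(\<lambda>k. LINT t|M. \<bar>f t - F k t\<bar> powr P) \<longlonglongrightarrow> 0" by simp
  from order_tendstoD(2)[OF this \<delta>] obtain k where "(LINT t|M. \<bar>f t - F k t\<bar> powr P) < \<delta>"
    by (auto simp: eventually_sequentially)
  then show ?thesis using F(1) intF by (intro exI[of _ "F k"]) simp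
qed

section \<open>Vectors and their representatives in L_p\<close>

lemma Lp_identification_diff:
  assumes J: "Lp_identification M p J"
  shows "AE t in M. J (x - y) t = J x t - J y t"
proof -
  have "AE t in M. J (x + (-1) *\<^sub>R y) t = J x t + J ((-1) *\<^sub>R y) t"
    and "AE t in M. J ((-1) *\<^sub>R y) t = (-1) * J y t"
    using J by (auto simp only: Lp_identification_def)
  then show ?thesis by eventually_elim simp
qed

text \<open>Representatives are linear only up to a null set depending on the vectors; a finite sum
  collects finitely many of them.\<close>

lemma Lp_identification_sum:
  assumes J: "Lp_identification M p J" and I: "finite I"
  shows "AE t in M. J (\<Sum>c\<in>I. a c *\<^sub>R u c) t = (\<Sum>c\<in>I. a c * J (u c) t)"
  using I
proof (induction I)
  case empty
  have "AE t in M. J (0 *\<^sub>R 0) t = 0 * J 0 t"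
    using J by (simp only: Lp_identification_def)
  then show ?case by simp
next
  case (insert c I)
  have "AE t in M. J (a c *\<^sub>R u c + (\<Sum>c\<in>I. a c *\<^sub>R u c)) t
      = J (a c *\<^sub>R u c) t + J (\<Sum>c\<in>I. a c *\<^sub>R u c) t"
    and "AE t in M. J (a c *\<^sub>R u c) t = a c * J (u c) t"
    using J by (auto simp only: Lp_identification_def)
  then show ?case using insert.IH
    by eventually_elim (use insert.hyps in simp)
qed

text \<open>The norm may be read off any measurable representative, in particular off an explicit
  combination of indicators.\<close>

lemma Lp_identification_norm_powr:
  assumes J: "Lp_identification M p J" and p: "p \<noteq> \<infinity>" "0 < enn2real p"
    and ae: "AE t in M. J x t = f t" and f: "f \<in> borel_measurable M"
  shows "norm x powr enn2real p = (LINT t|M. \<bar>f t\<bar> powr enn2real p)"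
proof -
  have Jx: "J x \<in> borel_measurable M"
    using J by (auto simp: Lp_identification_def Lp_functions_def)
  have "norm x = (LINT t|M. \<bar>J x t\<bar> powr enn2real p) powr (1 / enn2real p)"
    using J p by (simp add: Lp_identification_def Lp_norm_def)
  moreover have "0 \<le> (LINT t|M. \<bar>J x t\<bar> powr enn2real p)" by simp
  ultimately have "norm x powr enn2real p = (LINT t|M. \<bar>J x t\<bar> powr enn2real p)"
    using p by (simp add: powr_powr)
  also have "\<dots> = (LINT t|M. \<bar>f t\<bar> powr enn2real p)"
    by (rule integral_cong_AE) (use Jx f ae in \<open>auto elim: eventually_mono\<close>)
  finally show ?thesis .
qed

text \<open>The finitely many simple functions are constant on the atoms of a common finite partition;
  an atom is named by the tuple of their values on it.\<close>

lemma Lp_finite_approx: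
  fixes J :: "'a::real_normed_vector \<Rightarrow> 'm \<Rightarrow> real" and x :: "nat \<Rightarrow> 'a"
  assumes J: "Lp_identification M p J" and p: "p \<noteq> \<infinity>" "0 < enn2real p" and \<epsilon>: "0 < \<epsilon>"
  shows "\<exists>(I :: (nat \<Rightarrow> real) set) u \<xi>. finite I \<and>
    (\<forall>a. norm (\<Sum>c\<in>I. a c *\<^sub>R u c) powr enn2real p = (\<Sum>c\<in>I. \<bar>a c\<bar> powr enn2real p)) \<and>
    (\<forall>i<n. norm (x i - (\<Sum>c\<in>I. \<xi> i c *\<^sub>R u c)) < \<epsilon>)"
proof -
  define P where "P = enn2real p"
  have P: "0 < P" using p by (simp add: P_def)
  have fin: "J x \<in> Lp_functions M p" for x using J by (simp add: Lp_identification_def)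
  have Jx: "J x \<in> borel_measurable M" "integrable M (\<lambda>t. \<bar>J x t\<bar> powr P)" for x
    using fin[of x] p by (auto simp: Lp_functions_def P_def)
  have "\<forall>i. \<exists>s. simple_function M s \<and> integrable M (\<lambda>t. \<bar>s t\<bar> powr P) \<and>
      (LINT t|M. \<bar>J (x i) t - s t\<bar> powr P) < \<epsilon> powr P"
    by (intro allI simple_approx_powr Jx P) (use \<epsilon> in simp)
  then obtain s where s: "\<forall>i. simple_function M (s i) \<and> integrable M (\<lambda>t. \<bar>s i t\<bar> powr P) \<and>
      (LINT t|M. \<bar>J (x i) t - s i t\<bar> powr P) < \<epsilon> powr P"
    by (drule_tac choice) (elim exE, rule that)
  have s_meas[measurable]: "s i \<in> borel_measurable M" for i
    using s by (simp add: borel_measurable_simple_function)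
  \<comment> \<open>Extending the tuples by zero beyond n leaves only finitely many of them and
    makes equality of functions equality of the first n values.\<close>
  define vals where "vals t = (\<lambda>i. if i < n then s i t else 0)" for t
  define V where "V = vals ` space M"
  define A where "A c = {t \<in> space M. vals t = c}" for c
  define m where "m c = measure M (A c)" for c
  \<comment> \<open>The atom of the zero tuple may have infinite measure, but all s_i with i < n
    vanish on it. As \<open>measure\<close> is 0 on sets of infinite measure, \<open>0 < m c\<close>
    means positive and finite measure.\<close>
  define I where "I = {c \<in> V. c \<noteq> (\<lambda>_. 0) \<and> 0 < m c}"
  have finV: "finite V"
  proof (rule finite_subset)
    show "V \<subseteq> {f. \<forall>i. (i \<in> {..<n} \<longrightarrow> f i \<in> (\<Union>i<n. s i ` space M)) \<and> (i \<notin> {..<n} \<longrightarrow> f i = 0)}"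
      by (force simp: V_def vals_def)
    show "finite {f. \<forall>i. (i \<in> {..<n} \<longrightarrow> f i \<in> (\<Union>i<n. s i ` space M)) \<and>
        (i \<notin> {..<n} \<longrightarrow> f i = (0::real))}"
      by (intro finite_set_of_finite_funs finite_UN_I) (use s in \<open>auto simp: simple_function_def\<close>)
  qed
  then have finI: "finite I" by (simp add: I_def)
  have A[measurable]: "A c \<in> sets M" if "c \<in> V" for c
  proof -
    have c: "\<forall>i\<ge>n. c i = 0" using that by (auto simp: V_def vals_def)
    have "A c = {t \<in> space M. \<forall>i\<in>{..<n}. s i t = c i}"
      using c by (auto simp: A_def vals_def fun_eq_iff)
    also have "\<dots> \<in> sets M" by measurable
    finally show ?thesis .
  qed
  \<comment> \<open>\<open>m c = 0\<close> could also come from infinite measure; this is excluded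
    because some |s_i|^P is a positive constant on the atom and integrable.\<close>
  have null: "AE t in M. t \<notin> A c" if c: "c \<in> V" "c \<noteq> (\<lambda>_. 0)" "\<not> 0 < m c" for c
  proof -
    obtain i where i: "c i \<noteq> 0" using c(2) by auto
    then have "i < n" using c(1) by (auto simp: V_def vals_def split: if_splits)
    have "integrable M (\<lambda>t. \<bar>c i\<bar> powr P * indicator (A c) t)"
    proof (rule Bochner_Integration.integrable_bound)
      show "integrable M (\<lambda>t. \<bar>s i t\<bar> powr P)" using s by blast
      show "AE t in M. norm (\<bar>c i\<bar> powr P * indicator (A c) t) \<le> norm (\<bar>s i t\<bar> powr P)"
        using \<open>i < n\<close> by (intro AE_I2) (auto simp: A_def vals_def indicator_def)
    qed (use A[OF c(1)] in measurable)
    moreover have "\<bar>c i\<bar> powr P \<noteq> 0" using i by simp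
    ultimately have "integrable M (\<lambda>t. indicator (A c) t :: real)"
      by (simp only: integrable_mult_left_iff) simp
    then have "emeasure M (A c) < \<infinity>"
      using A[OF c(1)] by (simp add: integrable_indicator_iff sets.Int_space_eq2)
    then have "emeasure M (A c) = ennreal (m c)"
      unfolding m_def by (intro emeasure_eq_ennreal_measure) simp
    also have "m c = 0" using c(3) by (simp add: m_def zero_less_measure_iff)
    finally have "A c \<in> null_sets M" using A[OF c(1)] by auto
    then show ?thesis by (rule AE_not_in)
  qed
  \<comment> \<open>Indicators of disjoint atoms, scaled to norm 1, span an isometric copy of l_p on
    I.\<close>
  define g where "g c t = indicator (A c) t * m c powr (- (1 / P))" for c t
  have I_V: "c \<in> V" if "c \<in> I" for c using that by (simp add: I_def)
  have g_meas: "g c \<in> borel_measurable M" if "c \<in> I" for c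
    unfolding g_def using A[OF I_V[OF that]] by measurable
  have m_powr: "(m c powr (- (1 / P))) powr P = 1 / m c" if "0 < m c" for c
    unfolding powr_powr using that P by (simp add: powr_minus_divide)
  have g_powr: "\<bar>g c t\<bar> powr P = indicator (A c) t / m c" if "c \<in> I" for c t
    using that P by (auto simp: g_def indicator_def I_def m_powr)
  have ind_int: "integrable M (\<lambda>t. indicator (A c) t / m c)" if "c \<in> I" for c
  proof -
    have "emeasure M (A c) \<noteq> \<infinity>"
    proof
      assume "emeasure M (A c) = \<infinity>"
      then have "m c = 0" by (simp add: m_def measure_def)
      then show False using that by (simp add: I_def)
    qed
    then have "integrable M (indicator (A c) :: _ \<Rightarrow> real)"
      using A[OF I_V[OF that]] by (simp add: integrable_indicator_iff sets.Int_space_eq2 less_top)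
    then show ?thesis by simp
  qed
  have "\<forall>c\<in>I. \<exists>u. AE t in M. J u t = g c t"
  proof
    fix c assume c: "c \<in> I"
    have "g c \<in> Lp_functions M p"
      using p g_meas[OF c] ind_int[OF c]
      by (simp add: Lp_functions_def g_powr[OF c] flip: P_def)
    then show "\<exists>u. AE t in M. J u t = g c t"
      using J by (auto simp: Lp_identification_def)
  qed
  then obtain u where u: "\<forall>c\<in>I. AE t in M. J (u c) t = g c t"
    by (drule_tac bchoice) (elim exE, rule that)
  have Jsum: "AE t in M. J (\<Sum>c\<in>I. a c *\<^sub>R u c) t = (\<Sum>c\<in>I. a c * g c t)" for a
  proof -
    have "AE t in M. \<forall>c\<in>I. J (u c) t = g c t"
      using u by (intro AE_finite_allI finI) auto
    with Lp_identification_sum[OF J finI, of a u] show ?thesis by eventually_elim simp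
  qed
  have sum_g: "(\<Sum>c\<in>I. a c * g c t)
      = (if vals t \<in> I then a (vals t) * m (vals t) powr (- (1 / P)) else 0)"
    if "t \<in> space M" for a t
  proof -
    have "(\<Sum>c\<in>I. a c * g c t)
        = (\<Sum>c\<in>I. if c = vals t then a (vals t) * m (vals t) powr (- (1 / P)) else 0)"
      using that by (intro sum.cong) (auto simp: g_def A_def)
    then show ?thesis using finI by simp
  qed
  have "norm (\<Sum>c\<in>I. a c *\<^sub>R u c) powr P = (\<Sum>c\<in>I. \<bar>a c\<bar> powr P)" for a
  proof -
    have "norm (\<Sum>c\<in>I. a c *\<^sub>R u c) powr P = (LINT t|M. \<bar>\<Sum>c\<in>I. a c * g c t\<bar> powr P)"
      unfolding P_def
      by (rule Lp_identification_norm_powr[OF J p Jsum]) (use g_meas in measurable)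
    also have "\<dots> = (LINT t|M. (\<Sum>c\<in>I. \<bar>a c\<bar> powr P * (indicator (A c) t / m c)))"
    proof (rule Bochner_Integration.integral_cong[OF refl])
      fix t assume t: "t \<in> space M"
      have "(\<Sum>c\<in>I. \<bar>a c\<bar> powr P * (indicator (A c) t / m c))
          = (\<Sum>c\<in>I. if c = vals t then \<bar>a (vals t)\<bar> powr P / m (vals t) else 0)"
        using t by (intro sum.cong) (auto simp: A_def)
      also have "\<dots> = (if vals t \<in> I then \<bar>a (vals t)\<bar> powr P / m (vals t) else 0)"
        using finI by simp
      also have "\<dots> = \<bar>\<Sum>c\<in>I. a c * g c t\<bar> powr P"
        unfolding sum_g[OF t] using P
        by (auto simp: I_def abs_mult powr_mult m_powr)
      finally show "\<bar>\<Sum>c\<in>I. a c * g c t\<bar> powr P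
          = (\<Sum>c\<in>I. \<bar>a c\<bar> powr P * (indicator (A c) t / m c))" by (rule HOL.sym)
    qed
    also have "\<dots> = (\<Sum>c\<in>I. LINT t|M. \<bar>a c\<bar> powr P * (indicator (A c) t / m c))"
      by (rule Bochner_Integration.integral_sum) (intro integrable_mult_right ind_int)
    also have "\<dots> = (\<Sum>c\<in>I. \<bar>a c\<bar> powr P * (LINT t|M. indicator (A c) t / m c))"
      by (simp only: integral_mult_right_zero)
    also have "\<dots> = (\<Sum>c\<in>I. \<bar>a c\<bar> powr P)"
    proof (rule sum.cong[OF refl])
      fix c assume c: "c \<in> I"
      have "(LINT t|M. indicator (A c) t / m c) = m c / m c"
        using A[OF I_V[OF c]] by (simp add: m_def sets.Int_space_eq2)
      also have "\<dots> = 1" using c by (simp add: I_def)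
      finally show "\<bar>a c\<bar> powr P * (LINT t|M. indicator (A c) t / m c) = \<bar>a c\<bar> powr P" by simp
    qed
    finally show ?thesis .
  qed
  moreover have "norm (x i - (\<Sum>c\<in>I. (c i * m c powr (1 / P)) *\<^sub>R u c)) < \<epsilon>" if i: "i < n" for i
  proof -
    \<comment> \<open>The factor m^(1/P) undoes the normalization of g, so that ?w represents s_i
      almost everywhere.\<close>
    let ?w = "\<Sum>c\<in>I. (c i * m c powr (1 / P)) *\<^sub>R u c"
    have "AE t in M. \<forall>c\<in>{c \<in> V. c \<noteq> (\<lambda>_. 0) \<and> \<not> 0 < m c}. t \<notin> A c"
      using null finV by (intro AE_finite_allI) auto
    then have "AE t in M. (\<Sum>c\<in>I. c i * m c powr (1 / P) * g c t) = s i t"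
    proof (rule AE_mp, intro AE_I2 impI)
      fix t assume t: "t \<in> space M"
        and nn: "\<forall>c\<in>{c \<in> V. c \<noteq> (\<lambda>_. 0) \<and> \<not> 0 < m c}. t \<notin> A c"
      have "vals t \<in> V" "t \<in> A (vals t)" using t by (auto simp: V_def A_def)
      show "(\<Sum>c\<in>I. c i * m c powr (1 / P) * g c t) = s i t"
      proof (cases "vals t \<in> I")
        case True
        then have "m (vals t) powr (1 / P) * m (vals t) powr (- (1 / P)) = 1"
          by (simp add: I_def powr_minus)
        then have "vals t i * m (vals t) powr (1 / P) * m (vals t) powr (- (1 / P)) = vals t i"
          by (simp add: mult.assoc)
        then show ?thesis unfolding sum_g[OF t] using True i by (simp add: vals_def)
      next
        case False
        then have "vals t = (\<lambda>_. 0)"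
          using nn \<open>vals t \<in> V\<close> \<open>t \<in> A (vals t)\<close> by (auto simp: I_def)
        then have "vals t i = 0" by simp
        then show ?thesis unfolding sum_g[OF t] using False i by (simp add: vals_def)
      qed
    qed
    with Lp_identification_diff[OF J, of "x i" ?w] Jsum[of "\<lambda>c. c i * m c powr (1 / P)"]
    have "AE t in M. J (x i - ?w) t = J (x i) t - s i t" by eventually_elim simp
    then have "norm (x i - ?w) powr P = (LINT t|M. \<bar>J (x i) t - s i t\<bar> powr P)"
      unfolding P_def
      by (rule Lp_identification_norm_powr[OF J p]) (use Jx in measurable)
    also have "\<dots> < \<epsilon> powr P" using s by blast
    finally have lt: "norm (x i - ?w) powr P < \<epsilon> powr P" .
    show ?thesis
    proof (rule ccontr)
      assume "\<not> ?thesis"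
      then have "\<epsilon> powr P \<le> norm (x i - ?w) powr P" using \<epsilon> P by (intro powr_mono2) auto
      with lt show False by simp
    qed
  qed
  ultimately show ?thesis
    using finI unfolding P_def
    by (intro exI[of _ I] exI[of _ u] exI[of _ "\<lambda>i c. c i * m c powr (1 / enn2real p)"]) simp
qed

lemma exponent_inverse_eq:
  assumes "1 \<le> p" and "p \<noteq> \<infinity>"
  shows "1 \<le> enn2real p" and "exponent_inverse p = 1 / enn2real p"
proof -
  obtain r where r: "p = ennreal r" "0 \<le> r" using assms(2) by (cases p) auto
  then have "1 \<le> r" using assms(1) by simp
  then show "1 \<le> enn2real p" "exponent_inverse p = 1 / enn2real p"
    using r divide_ennreal[of 1 r] by (simp_all add: exponent_inverse_def)
qed

lemma abs_fdet_Lp_duality_le: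
  fixes J :: "'a::real_normed_vector \<Rightarrow> 'm \<Rightarrow> real"
    and x :: "nat \<Rightarrow> 'a" and b :: "nat \<Rightarrow> 'a \<Rightarrow>\<^sub>L real"
  assumes n: "1 \<le> n" and p: "p \<noteq> \<infinity>" "1 < enn2real p" and J: "Lp_identification M p J"
    and x: "\<forall>i<n. norm (x i) \<le> 1" and b: "\<forall>j<n. norm (b j) \<le> 1"
  shows "\<bar>fdet n (\<lambda>i j. blinfun_apply (b j) (x i))\<bar>
    \<le> (real n powr \<bar>1 / enn2real p - 1 / 2\<bar>) ^ n"
proof (rule abs_fdet_le_approximation)
  define P where "P = enn2real p"
  have P: "1 < P" "0 < enn2real p" using p by (auto simp: P_def)
  define q where "q = P / (P - 1)"
  have pq: "1 / P + 1 / q = 1" using P by (simp add: q_def field_simps)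
  fix \<epsilon> :: real assume "0 < \<epsilon>"
  define \<delta> where "\<delta> = \<epsilon> / 2"
  have \<delta>: "0 < \<delta>" using \<open>0 < \<epsilon>\<close> by (simp add: \<delta>_def)
  from Lp_finite_approx[OF J p(1) P(2) \<delta>, of n x]
  obtain I :: "(nat \<Rightarrow> real) set" and u \<xi> where
    u: "\<forall>a. norm (\<Sum>c\<in>I. a c *\<^sub>R u c) powr P = (\<Sum>c\<in>I. \<bar>a c\<bar> powr P)"
    and \<xi>: "\<forall>i<n. norm (x i - (\<Sum>c\<in>I. \<xi> i c *\<^sub>R u c)) < \<delta>"
    by (fold P_def) (elim exE conjE, rule that)
  \<comment> \<open>The approximants w_i have norm up to 1 + \<delta>. Scaling them back into the
    unit ball moves them by at most another \<delta>, whence \<delta> = \<epsilon>/2.\<close>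
  define X where "X i c = \<xi> i c / (1 + \<delta>)" for i c
  define w where "w i = (\<Sum>c\<in>I. \<xi> i c *\<^sub>R u c)" for i
  define x' where "x' i = (\<Sum>c\<in>I. X i c *\<^sub>R u c)" for i
  have x'w: "x' i = (1 / (1 + \<delta>)) *\<^sub>R w i" for i
    by (simp add: x'_def w_def X_def scaleR_sum_right)
  have w: "norm (w i) \<le> 1 + \<delta>" "norm (x i - w i) < \<delta>" if "i < n" for i
  proof -
    show lt: "norm (x i - w i) < \<delta>" using \<xi> that by (simp add: w_def)
    have "norm (x i) \<le> 1" using x that by blast
    then show "norm (w i) \<le> 1 + \<delta>"
      using lt norm_triangle_ineq2[of "w i" "x i"] by (simp add: norm_minus_commute)
  qed
  have x': "norm (x' i) \<le> 1" if "i < n" for i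
    using w(1)[OF that] \<delta> by (simp add: x'w field_simps)
  have near: "norm (x i - x' i) < \<epsilon>" if "i < n" for i
  proof -
    have "w i - x' i = (1 - 1 / (1 + \<delta>)) *\<^sub>R w i"
      by (simp add: x'w scaleR_left_diff_distrib)
    also have "1 - 1 / (1 + \<delta>) = \<delta> / (1 + \<delta>)" using \<delta> by (simp add: field_simps)
    finally have "w i - x' i = (\<delta> / (1 + \<delta>)) *\<^sub>R w i" .
    then have "norm (w i - x' i) = \<delta> / (1 + \<delta>) * norm (w i)" using \<delta> by simp
    also have "\<dots> \<le> \<delta> / (1 + \<delta>) * (1 + \<delta>)" using w(1)[OF that] \<delta> by (intro mult_left_mono) auto
    also have "\<dots> = \<delta>" using \<delta> by simp
    finally have "norm (w i - x' i) \<le> \<delta>" .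
    then have "norm ((x i - w i) + (w i - x' i)) < \<delta> + \<delta>"
      using w(2)[OF that] norm_triangle_ineq[of "x i - w i" "w i - x' i"] by linarith
    then show ?thesis by (simp add: \<delta>_def)
  qed
  have "\<bar>fdet n (\<lambda>i j. \<Sum>c\<in>I. X i c * blinfun_apply (b j) (u c))\<bar>
      \<le> (real n powr \<bar>1 / P - 1 / 2\<bar>) ^ n"
  proof (rule abs_fdet_lp_duality_le[OF n P(1) pq])
    fix i assume i: "i < n"
    have "norm (x' i) powr P \<le> 1" using x'[OF i] P by (intro powr_le1) auto
    then show "(\<Sum>c\<in>I. \<bar>X i c\<bar> powr P) \<le> 1" using u by (simp add: x'_def)
  next
    fix j assume "j < n"
    then show "(\<Sum>c\<in>I. \<bar>blinfun_apply (b j) (u c)\<bar> powr q) \<le> 1"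
      using b by (intro lp_basis_dual_norm[OF P(1) pq]) (use u in auto)
  qed
  then have "\<bar>fdet n (\<lambda>i j. blinfun_apply (b j) (x' i))\<bar>
      \<le> (real n powr \<bar>1 / enn2real p - 1 / 2\<bar>) ^ n"
    by (simp add: x'_def blinfun.sum_right blinfun.scaleR_right P_def)
  then show "\<exists>x'. (\<forall>i<n. norm (x i - x' i) < \<epsilon>) \<and>
      \<bar>fdet n (\<lambda>i j. blinfun_apply (b j) (x' i))\<bar> \<le> (real n powr \<bar>1 / enn2real p - 1 / 2\<bar>) ^ n"
    using near by (intro exI[of _ x']) simp
qed

lemma grothendieck_number_Lp_le:
  fixes J :: "'a::real_normed_vector \<Rightarrow> 'm \<Rightarrow> real"
  assumes n: "1 \<le> n" and p: "1 \<le> p" and J: "Lp_identification M p J"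
  shows "grothendieck_number TYPE('a) n \<le> real n powr \<bar>exponent_inverse p - 1 / 2\<bar>"
proof (rule grothendieck_number_le[OF n])
  fix x :: "nat \<Rightarrow> 'a" and b :: "nat \<Rightarrow> 'a \<Rightarrow>\<^sub>L real"
  assume x: "\<forall>i<n. norm (x i) \<le> 1" and b: "\<forall>j<n. norm (b j) \<le> 1"
  show "\<bar>fdet n (\<lambda>i j. blinfun_apply (b j) (x i))\<bar>
      \<le> (real n powr \<bar>exponent_inverse p - 1 / 2\<bar>) ^ n"
  proof (cases "p \<noteq> \<infinity> \<and> 1 < enn2real p")
    case True
    then show ?thesis
      using abs_fdet_Lp_duality_le[OF n _ _ J x b] exponent_inverse_eq[OF p] by simp
  next
    \<comment> \<open>Only p = 1 and p = infinity remain. Both have exponent 1/2, and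
      \<open>abs_fdet_duality_le\<close> gives this in every normed space.\<close>
    case False
    have "\<bar>exponent_inverse p - 1 / 2\<bar> = 1 / 2"
    proof (cases "p = \<infinity>")
      case True
      then show ?thesis by (simp add: exponent_inverse_def)
    next
      case p': False
      with False exponent_inverse_eq[OF p p'] have "exponent_inverse p = 1" by simp
      then show ?thesis by simp
    qed
    then have "real n powr \<bar>exponent_inverse p - 1 / 2\<bar> = sqrt (real n)"
      by (simp only: powr_half_sqrt of_nat_0_le_iff)
    then show ?thesis using abs_fdet_duality_le[of n x b] x b by simp
  qed
qed simp

subsection \<open>Polynomially decaying widths\<close>

text \<open>n^n / n! is a single term of the exponential series at n.\<close>

lemma power_self_le_exp_fact: "real n ^ n \<le> exp 1 ^ n * fact n"
proof -
  have "real n ^ n / fact n \<le> exp (real n)"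
  proof -
    have "(\<lambda>k. real n ^ k /\<^sub>R fact k) sums exp (real n)" by (rule exp_converges)
    then have "(\<lambda>k. real n ^ k / fact k) sums exp (real n)" by (simp add: field_simps)
    then have "sum (\<lambda>k. real n ^ k / fact k) {n} \<le> exp (real n)"
      by (rule sums_unique[THEN ssubst], intro sum_le_suminf) (auto simp: sums_iff)
    then show ?thesis by simp
  qed
  then show ?thesis by (simp add: field_simps exp_of_nat_mult[symmetric])
qed

text \<open>The product of k^(-s) over 0 < k < n is ((n-1)!)^(-s), and the n-th root of (n-1)! is at
  least n / (2e).\<close>

lemma root_prod_powr_le:
  fixes d :: "nat \<Rightarrow> real"
  assumes s: "0 < s" and C0: "0 < C0"
    and d0: "\<And>k. 0 \<le> d k"
    and d: "\<And>k. 1 \<le> k \<Longrightarrow> d k \<le> C0 * real k powr (- s)"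
  shows "\<exists>C>0. \<forall>n\<ge>1. root n (\<Prod>k<n. d k) \<le> C * real n powr (- s)"
proof -
  define A where "A = max 1 (d 0)"
  define B where "B = max 1 C0"
  \<comment> \<open>In 2e the e comes from n^n <= e^n n!, and the 2 from n! = n (n-1)! with n <=
    2^n.\<close>
  define C where "C = A * B * (2 * exp 1) powr s"
  have A: "1 \<le> A" "d 0 \<le> A" by (auto simp: A_def)
  have B: "1 \<le> B" "C0 \<le> B" by (auto simp: B_def)
  have AB: "1 \<le> A * B" using mult_mono[OF A(1) B(1)] A(1) by simp
  \<comment> \<open>The index 0 is outside the decay assumption, and \<open>0 powr (- s)\<close> is
    0 by convention, so this factor is set to 1.\<close>
  have dAB: "d k \<le> A * B * (if k = 0 then 1 else real k powr (- s))" for k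
  proof (cases "k = 0")
    case True
    have "A * 1 \<le> A * B" using A B by (intro mult_left_mono) auto
    then have "d 0 \<le> A * B" using A(2) by linarith
    then show ?thesis using True by simp
  next
    case False
    then have "d k \<le> C0 * real k powr (- s)" by (intro d) simp
    also have "\<dots> \<le> (1 * B) * real k powr (- s)" using B by (intro mult_right_mono) auto
    also have "\<dots> \<le> (A * B) * real k powr (- s)" using A B by (intro mult_right_mono) auto
    finally show ?thesis using False by simp
  qed
  have "root n (\<Prod>k<n. d k) \<le> C * real n powr (- s)" if n: "1 \<le> n" for n
  proof -
    obtain m where m: "n = Suc m" using n by (cases n) auto
    have prod: "(\<Prod>k<n. if k = 0 then 1 else real k powr (- s)) = fact m powr (- s)"
      unfolding m
    proof (induction m)
      case (Suc m)
      then show ?case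
        by (subst prod.lessThan_Suc) (simp add: powr_mult mult.commute)
    qed simp
    have n_le: "real n \<le> 2 ^ n" using less_exp[of n] of_nat_mono[of n "2 ^ n", where 'a=real] by simp
    have fact: "real n ^ n \<le> (2 * exp 1) ^ n * fact m"
    proof -
      have "real n ^ n \<le> exp 1 ^ n * fact n" by (rule power_self_le_exp_fact)
      also have "fact n = real n * fact m" by (simp add: m)
      also have "exp 1 ^ n * (real n * fact m) \<le> exp 1 ^ n * (2 ^ n * fact m)"
        using n_le by (intro mult_left_mono mult_right_mono) auto
      finally show ?thesis by (simp add: power_mult_distrib ac_simps)
    qed
    have "(\<Prod>k<n. d k) \<le> (\<Prod>k<n. A * B * (if k = 0 then 1 else real k powr (- s)))"
      by (intro prod_mono conjI d0 dAB)
    also have "\<dots> = (A * B) ^ n * fact m powr (- s)"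
      by (simp add: prod.distrib prod)
    also have "\<dots> \<le> (A * B) ^ n * ((2 * exp 1) powr s * real n powr (- s)) ^ n"
    proof (rule mult_left_mono)
      define z where "z = real n / (2 * exp 1)"
      have z: "0 < z" using n by (simp add: z_def)
      have "fact m powr (- s) \<le> (z ^ n) powr (- s)"
        using s z fact by (intro powr_mono2') (auto simp: z_def power_divide field_simps)
      also have "\<dots> = (z powr (- s)) ^ n"
        using z by (simp add: powr_realpow[symmetric] powr_powr mult.commute)
      also have "z powr (- s) = (2 * exp 1) powr s * real n powr (- s)"
        using n by (simp add: z_def powr_divide powr_minus field_simps)
      finally show "fact m powr (- s) \<le> ((2 * exp 1) powr s * real n powr (- s)) ^ n" .
    qed (use AB in simp)
    finally have "(\<Prod>k<n. d k) \<le> (C * real n powr (- s)) ^ n"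
      by (simp add: C_def power_mult_distrib ac_simps)
    then have "root n (\<Prod>k<n. d k) \<le> root n ((C * real n powr (- s)) ^ n)"
      using n by (intro real_root_le_mono) auto
    also have "\<dots> = C * real n powr (- s)"
      using n AB by (intro real_root_power_cancel) (auto simp: C_def)
    finally show ?thesis .
  qed
  moreover have "0 < C" using AB by (simp add: C_def)
  ultimately show ?thesis by blast
qed

theorem corollary3p6:
  fixes K :: "'a::banach set"
    and T :: "'h::{real_inner, banach} \<Rightarrow>\<^sub>L 'a"
  assumes "compact K" and "K \<noteq> {}"
    and "compact_operator T"
    and "K \<subseteq> blinfun_apply T ` cball 0 1"
  shows "(\<forall>f. greedy_sequence K f \<longrightarrow> (\<forall>n\<ge>1.
            greedy_error f (3 * n - 1)
              \<le> 3 * (exp 1)\<^sup>2 * grothendieck_number TYPE('a) n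
                  * root n (\<Prod>k<n. kolmogorov_width T k))) \<and>
         (\<forall>(M :: 'm measure) (p :: ennreal) (J :: 'a \<Rightarrow> 'm \<Rightarrow> real) (C0 :: real) (s :: real).
            1 \<le> p \<longrightarrow> Lp_identification M p J \<longrightarrow>
            0 < C0 \<longrightarrow> s > \<bar>1 / 2 - exponent_inverse p\<bar> \<longrightarrow>
            (\<forall>n\<ge>1. kolmogorov_width T n \<le> C0 * real n powr (- s)) \<longrightarrow>
            (\<exists>C>0. \<forall>f. greedy_sequence K f \<longrightarrow> (\<forall>n\<ge>1.
               greedy_error f n \<le> C * real n powr (\<bar>exponent_inverse p - 1 / 2\<bar> - s))))"
proof (intro conjI allI impI)
  fix f and n :: nat assume f: "greedy_sequence K f" and n: "1 \<le> n"
  let ?E = "grothendieck_number TYPE('a) n * root n (\<Prod>k<n. kolmogorov_width T k)"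
  have "0 \<le> ?E"
    using n by (intro mult_nonneg_nonneg grothendieck_number_nonneg real_root_ge_zero
        prod_nonneg kolmogorov_width_nonneg)
  \<comment> \<open>\<open>greedy_error_le\<close> is weakened twice: 3 e^2 exceeds 1, and the error
    at 3n - 1 is at most the one at n - 1.\<close>
  moreover have "1 \<le> 3 * (exp 1 :: real)\<^sup>2"
    using one_le_power[of "exp 1 :: real" 2] one_le_exp_iff[of "1 :: real"] by linarith
  ultimately have "1 * ?E \<le> 3 * (exp 1)\<^sup>2 * ?E" by (intro mult_right_mono)
  moreover have "greedy_error f (3 * n - 1) \<le> greedy_error f (n - 1)"
    using n by (intro greedy_error_antimono[OF f]) simp
  ultimately show "greedy_error f (3 * n - 1)
      \<le> 3 * (exp 1)\<^sup>2 * grothendieck_number TYPE('a) n * root n (\<Prod>k<n. kolmogorov_width T k)"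
    using greedy_error_le[OF assms(4) f n] by (simp add: mult.assoc)
next
  fix M :: "'m measure" and p :: ennreal and J :: "'a \<Rightarrow> 'm \<Rightarrow> real" and C0 s :: real
  assume p: "1 \<le> p" and J: "Lp_identification M p J" and C0: "0 < C0"
    and s: "s > \<bar>1 / 2 - exponent_inverse p\<bar>"
    and d: "\<forall>n\<ge>1. kolmogorov_width T n \<le> C0 * real n powr (- s)"
  have "0 < s" using s by linarith
  then have "\<exists>C>0. \<forall>n\<ge>1. root n (\<Prod>k<n. kolmogorov_width T k) \<le> C * real n powr (- s)"
    using C0 d by (intro root_prod_powr_le[of s C0] kolmogorov_width_nonneg) auto
  then obtain C where C: "0 < C"
    "\<forall>n\<ge>1. root n (\<Prod>k<n. kolmogorov_width T k) \<le> C * real n powr (- s)"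
    by (elim exE conjE) (rule that)
  have "greedy_error f n \<le> C * real n powr (\<bar>exponent_inverse p - 1 / 2\<bar> - s)"
    if f: "greedy_sequence K f" and n: "1 \<le> n" for f n
  proof -
    \<comment> \<open>The estimate concerns index n - 1; monotonicity passes to n without shifting
      the power of n.\<close>
    have "greedy_error f n \<le> greedy_error f (n - 1)"
      by (intro greedy_error_antimono[OF f]) simp
    also have "\<dots> \<le> grothendieck_number TYPE('a) n * root n (\<Prod>k<n. kolmogorov_width T k)"
      by (rule greedy_error_le[OF assms(4) f n])
    also have "\<dots> \<le> real n powr \<bar>exponent_inverse p - 1 / 2\<bar> * (C * real n powr (- s))"
      using n C(2) by (intro mult_mono grothendieck_number_Lp_le[OF n p J] real_root_ge_zero
          prod_nonneg kolmogorov_width_nonneg) auto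
    also have "\<dots> = C * real n powr (\<bar>exponent_inverse p - 1 / 2\<bar> - s)"
      using powr_add[of "real n" "\<bar>exponent_inverse p - 1 / 2\<bar>" "- s"] by simp
    finally show ?thesis .
  qed
  with C(1) show "\<exists>C>0. \<forall>f. greedy_sequence K f \<longrightarrow> (\<forall>n\<ge>1.
      greedy_error f n \<le> C * real n powr (\<bar>exponent_inverse p - 1 / 2\<bar> - s))"
    by (intro exI[of _ C]) simp
qed

end
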